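(* Let $u\le_k w$ in $S_n$. The ordering $<_{\mathrm{lex}}$ of the facets of the simplicial complex $\sigma_k(\Delta([u,w]))$ is a shelling order.
   Context: Fix integers $0\le k\le n$. On $S_n$, $\ell$ is the number of inversions, $\le$ is Bruhat order with covers $\lessdot$, and $\sigma_k(v)=v([k])$, a $k$-element subset of $[n]$. The $k$-Bruhat order $\le_k$ is the reflexive-transitive closure of: $x\lessdot_k y$ iff $x\lessdot y$ and $\sigma_k(x)\ne\sigma_k(y)$. $[u,w]$ and $[u,w]_k$ are the Bruhat and $k$-Bruhat intervals. $\Delta([u,w])$ is the order complex of $[u,w]$ (faces are chains), and $\sigma_k(\Delta([u,w]))$ is the simplicial complex whose faces are the images under $\sigma_k$ of chains of $[u,w]$. For $u\le_k w$, the complex $\sigma_k(\Delta([u,w]))$ is pure of dimension $\ell(w)-\ell(u)$, and each facet is the image of precisely one maximal chain of $[u,w]$, which is moreover a maximal chain $u=v_0\lessdot_k v_1\lessdot_k\cdots\lessdot_k v_m=w$ of $[u,w]_k$. Ordering of facets: each cover $x\lessdot_k x\,(i\,j)$ in $[u,w]_k$, with $i\le k<j$, is labeled by the transposition $(i\,j)$. Totally order the transpositions $(i\,j)$ with $i\le k<j$ by: $(i\,j)<(i'\,j')$ if $w(i)>w(i')$; and $(i\,j)<(i\,j')$ if $w(j)<w(j')$. Label each maximal chain of $[u,w]_k$ by its sequence of transpositions read from bottom ($u$) to top ($w$), and order maximal chains lexicographically by these label sequences. The induced order on facets of $\sigma_k(\Delta([u,w]))$ is $<_{\mathrm{lex}}$.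 An ordering $\sigma_1,\dots,\sigma_N$ of the facets of a simplicial complex all of whose facets have dimension $d-1$ is a shelling order if, for each $i>1$, $\sigma_i\cap\bigcup_{j<i}\sigma_j$ is pure of dimension $d-2$. *)

theory Defs
  imports "HOL-Combinatorics.Permutations"
begin

text \<open>
  Elements of the symmetric group on \<open>{1..n}\<close> are functions \<open>v\<close> with \<open>v permutes {1..n}\<close>.
  The product \<open>x (i j)\<close> is \<open>x \<circ> transpose i j\<close>, so that \<open>(i j)\<close> exchanges positions.
\<close>

definition perm_length :: "nat \<Rightarrow> (nat \<Rightarrow> nat) \<Rightarrow> nat" where
  "perm_length n v = card {(i, j). 1 \<le> i \<and> i < j \<and> j \<le> n \<and> v i > v j}"

definition sigma :: "nat \<Rightarrow> (nat \<Rightarrow> nat) \<Rightarrow> nat set" where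
  "sigma k v = v ` {1..k}"

definition bruhat_step :: "nat \<Rightarrow> (nat \<Rightarrow> nat) \<Rightarrow> (nat \<Rightarrow> nat) \<Rightarrow> bool" where
  "bruhat_step n x y \<longleftrightarrow> x permutes {1..n} \<and>
     (\<exists>i j. 1 \<le> i \<and> i < j \<and> j \<le> n \<and> y = x \<circ> transpose i j) \<and>
     perm_length n x < perm_length n y"

definition bruhat_le :: "nat \<Rightarrow> (nat \<Rightarrow> nat) \<Rightarrow> (nat \<Rightarrow> nat) \<Rightarrow> bool" where
  "bruhat_le n = (bruhat_step n)\<^sup>*\<^sup>*"

definition bruhat_less :: "nat \<Rightarrow> (nat \<Rightarrow> nat) \<Rightarrow> (nat \<Rightarrow> nat) \<Rightarrow> bool" where
  "bruhat_less n x y \<longleftrightarrow> bruhat_le n x y \<and> x \<noteq> y"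

definition bruhat_cover :: "nat \<Rightarrow> (nat \<Rightarrow> nat) \<Rightarrow> (nat \<Rightarrow> nat) \<Rightarrow> bool" where
  "bruhat_cover n x y \<longleftrightarrow> bruhat_less n x y \<and> \<not> (\<exists>z. bruhat_less n x z \<and> bruhat_less n z y)"

definition bruhat_interval :: "nat \<Rightarrow> (nat \<Rightarrow> nat) \<Rightarrow> (nat \<Rightarrow> nat) \<Rightarrow> (nat \<Rightarrow> nat) set" where
  "bruhat_interval n u w = {v. v permutes {1..n} \<and> bruhat_le n u v \<and> bruhat_le n v w}"

definition k_bruhat_cover :: "nat \<Rightarrow> nat \<Rightarrow> (nat \<Rightarrow> nat) \<Rightarrow> (nat \<Rightarrow> nat) \<Rightarrow> bool" where
  "k_bruhat_cover n k x y \<longleftrightarrow> bruhat_cover n x y \<and> sigma k x \<noteq> sigma k y"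

definition k_bruhat_le :: "nat \<Rightarrow> nat \<Rightarrow> (nat \<Rightarrow> nat) \<Rightarrow> (nat \<Rightarrow> nat) \<Rightarrow> bool" where
  "k_bruhat_le n k = (k_bruhat_cover n k)\<^sup>*\<^sup>*"

text \<open>
  A simplicial complex is represented by its set of faces. The empty face, of dimension
  \<open>-1\<close>, is a face of every complex considered here; dimensions are therefore integers.
\<close>

definition face_dim :: "'a set \<Rightarrow> int" where
  "face_dim F = int (card F) - 1"

definition facets :: "'a set set \<Rightarrow> 'a set set" where
  "facets K = {F \<in> K. \<forall>G\<in>K. F \<subseteq> G \<longrightarrow> F = G}"

definition pure_of_dim :: "'a set set \<Rightarrow> int \<Rightarrow> bool" where
  "pure_of_dim K d \<longleftrightarrow> K \<noteq> {} \<and> (\<forall>F\<in>facets K. face_dim F = d)"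

definition order_complex :: "('a \<Rightarrow> 'a \<Rightarrow> bool) \<Rightarrow> 'a set \<Rightarrow> 'a set set" where
  "order_complex le P = {C. finite C \<and> C \<subseteq> P \<and> (\<forall>x\<in>C. \<forall>y\<in>C. le x y \<or> le y x)}"

text \<open>
  The ordering is a list, indexed from 0, so the first facet is \<open>Fs ! 0\<close>. The facet \<open>F\<close>
  viewed as a simplicial complex is \<open>Pow F\<close>.
\<close>

definition shelling_order :: "'a set set \<Rightarrow> 'a set list \<Rightarrow> bool" where
  "shelling_order K Fs \<longleftrightarrow> distinct Fs \<and> set Fs = facets K \<and>
     (\<exists>d. pure_of_dim K (d - 1) \<and>
       (\<forall>i. 0 < i \<and> i < length Fs \<longrightarrow>
         pure_of_dim (Pow (Fs ! i) \<inter> (\<Union>j<i. Pow (Fs ! j))) (d - 2)))"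

definition sigma_complex :: "nat \<Rightarrow> nat \<Rightarrow> (nat \<Rightarrow> nat) \<Rightarrow> (nat \<Rightarrow> nat) \<Rightarrow> nat set set set" where
  "sigma_complex n k u w =
     (\<lambda>C. sigma k ` C) ` order_complex (bruhat_le n) (bruhat_interval n u w)"

text \<open>
  A maximal chain of the k-Bruhat interval is given as a saturated list from \<open>u\<close> to \<open>w\<close>;
  its entries lie in the interval automatically.
\<close>

definition k_max_chain ::
    "nat \<Rightarrow> nat \<Rightarrow> (nat \<Rightarrow> nat) \<Rightarrow> (nat \<Rightarrow> nat) \<Rightarrow> (nat \<Rightarrow> nat) list \<Rightarrow> bool" where
  "k_max_chain n k u w c \<longleftrightarrow>
     c \<noteq> [] \<and> hd c = u \<and> last c = w \<and> successively (k_bruhat_cover n k) c"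

definition cover_label :: "nat \<Rightarrow> nat \<Rightarrow> (nat \<Rightarrow> nat) \<Rightarrow> (nat \<Rightarrow> nat) \<Rightarrow> nat \<times> nat" where
  "cover_label n k x y =
     (THE (i, j). 1 \<le> i \<and> i \<le> k \<and> k < j \<and> j \<le> n \<and> y = x \<circ> transpose i j)"

definition chain_labels :: "nat \<Rightarrow> nat \<Rightarrow> (nat \<Rightarrow> nat) list \<Rightarrow> (nat \<times> nat) list" where
  "chain_labels n k c = map2 (cover_label n k) c (tl c)"

text \<open>The order on labels depends on the top element \<open>w\<close> of the interval.\<close>

definition label_less :: "(nat \<Rightarrow> nat) \<Rightarrow> nat \<times> nat \<Rightarrow> nat \<times> nat \<Rightarrow> bool" where
  "label_less w = (\<lambda>(i, j) (i', j'). w i > w i' \<or> i = i' \<and> w j < w j')"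

definition chain_lex_less ::
    "nat \<Rightarrow> nat \<Rightarrow> (nat \<Rightarrow> nat) \<Rightarrow> (nat \<Rightarrow> nat) list \<Rightarrow> (nat \<Rightarrow> nat) list \<Rightarrow> bool" where
  "chain_lex_less n k w c d \<longleftrightarrow>
     (chain_labels n k c, chain_labels n k d) \<in> lexord {(a, b). label_less w a b}"

text \<open>
  Each facet of \<open>sigma_complex n k u w\<close> is the image of exactly one maximal chain of the
  k-Bruhat interval, so the description below is well defined on facets.
\<close>

definition facet_chain ::
    "nat \<Rightarrow> nat \<Rightarrow> (nat \<Rightarrow> nat) \<Rightarrow> (nat \<Rightarrow> nat) \<Rightarrow> nat set set \<Rightarrow> (nat \<Rightarrow> nat) list" where
  "facet_chain n k u w F = (THE c. k_max_chain n k u w c \<and> sigma k ` set c = F)"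

definition facet_lex_less ::
    "nat \<Rightarrow> nat \<Rightarrow> (nat \<Rightarrow> nat) \<Rightarrow> (nat \<Rightarrow> nat) \<Rightarrow> nat set set \<Rightarrow> nat set set \<Rightarrow> bool" where
  "facet_lex_less n k u w F G \<longleftrightarrow>
     chain_lex_less n k w (facet_chain n k u w F) (facet_chain n k u w G)"

end

theory Submission
  imports Defs
begin

text \<open>
  Write a saturated chain of the k-Bruhat order as its word of labels. If a same-side transposition
  \<open>(a b)\<close> covers the start of such a chain, conjugating by \<open>(a b)\<close> either carries it to the end of
  the chain, or meets a step that uninverts \<open>(a, b)\<close>, where it is absorbed and the chain
  gains one vertex; in both cases the image under \<open>\<sigma>\<^sub>k\<close> only grows. Together with the
  generalized lifting property of the Bruhat order this puts the image of every Bruhat chain inside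
  the image of a saturated k-Bruhat chain, which identifies the facets.

  For the shelling, let a chain \<open>d\<close> precede a chain \<open>c\<close>, and follow \<open>c\<close> from the point where they
  part to the next vertex whose image under \<open>\<sigma>\<^sub>k\<close> lies in the facet of \<open>d\<close>. The labels of \<open>c\<close>
  cannot increase all the way there: along increasing labels no value on the first \<open>k\<close> positions
  crosses a level that \<open>d\<close> has already crossed. At a descent strictly in between, an exchange of the
  two labels (or a same-side transposition carried upwards, when they share an index) gives an
  earlier facet that contains all of \<open>c\<close>'s facet but the descent vertex.
\<close>

section \<open>Length and covers\<close>

text \<open>Pairs of positions whose order the transposition keeps are merely relocated. Among the
  remaining pairs, the pair \<open>(i, j)\<close> becomes an inversion, and each position in between
  with an intermediate value becomes inverted with both ends; no inversion is lost.\<close>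

lemma perm_length_transpose:
  assumes v: "v permutes {1..n}" and ij: "1 \<le> i" "i < j" "j \<le> n" and vij: "v i < v j"
  shows "perm_length n (v \<circ> transpose i j) =
    perm_length n v + 1 + 2 * card {l. i < l \<and> l < j \<and> v i < v l \<and> v l < v j}"
proof -
  define I where "I v = {(p, q). 1 \<le> p \<and> p < q \<and> q \<le> n \<and> v p > v q}" for v :: "nat \<Rightarrow> nat"
  define t where "t = (transpose i j :: nat \<Rightarrow> nat)"
  \<comment> \<open>These are exactly the pairs whose order \<open>t\<close> reverses. Off
    \<open>E\<close>, \<open>map_prod t t\<close> matches the inversions of the two
    permutations.\<close>
  define E where "E = insert (i, j) (Pair i ` {i<..<j} \<union> (\<lambda>l. (l, j)) ` {i<..<j})"
  let ?v = "v \<circ> t"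
  let ?M = "{l. i < l \<and> l < j \<and> v i < v l \<and> v l < v j}"
  let ?L = "{l. i < l \<and> l < j \<and> v l < v i}"
  let ?H = "{l. i < l \<and> l < j \<and> v j < v l}"
  have inj: "v a = v b \<longleftrightarrow> a = b" for a b
    using v permutes_inj injD by metis
  have finI: "finite (I v)" for v
    by (rule finite_subset[of _ "{1..n} \<times> {1..n}"]) (auto simp: I_def)
  have fin [simp]: "finite ?M" "finite ?L" "finite ?H"
    by (rule finite_subset[of _ "{i<..<j}"]; auto)+
  have key: "1 \<le> t p \<and> t p < t q \<and> t q \<le> n \<and> (t p, t q) \<notin> E"
    if pq: "1 \<le> p" "p < q" "q \<le> n" "(p, q) \<notin> E" for p q
  proof -
    have E: "(p, q) \<in> E \<longleftrightarrow> p = i \<and> q = j \<or> p = i \<and> i < q \<and> q < j \<or> q = j \<and> i < p \<and> p < j" for p q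
      by (auto simp: E_def)
    consider "p = i" "q > j" | "p = j" | "q = i" | "q = j" "p < i" | "p \<noteq> i" "p \<noteq> j" "q \<noteq> i" "q \<noteq> j"
      using pq ij unfolding E by (metis linorder_neqE_nat)
    then show ?thesis
      by cases (use pq ij in \<open>simp_all add: E t_def transpose_def\<close>)
  qed
  have tt: "t (t p) = p" for p
    by (simp add: t_def)
  have "bij_betw (map_prod t t) (I ?v - E) (I v - E)"
    by (rule bij_betw_byWitness[where f' = "map_prod t t"])
      (use key in \<open>auto simp: I_def tt\<close>)
  then have off: "card (I ?v - E) = card (I v - E)"
    by (rule bij_betw_same_card)
  have Iv: "I v \<inter> E = Pair i ` ?L \<union> (\<lambda>l. (l, j)) ` ?H"
    using ij vij by (auto simp: I_def E_def image_iff)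
  have lt: "v l < v j \<longleftrightarrow> v l < v i \<or> v i < v l \<and> v l < v j" 
    and gt: "v i < v l \<longleftrightarrow> v j < v l \<or> v i < v l \<and> v l < v j" if "i < l" "l < j" for l
    using vij inj[of l i] inj[of l j] that by linarith+
  have "I ?v \<inter> E = insert (i, j) (Pair i ` {l. i < l \<and> l < j \<and> v l < v j} \<union>
      (\<lambda>l. (l, j)) ` {l. i < l \<and> l < j \<and> v i < v l})"
    using ij vij by (auto simp: I_def E_def t_def image_iff transpose_def)
  also have "{l. i < l \<and> l < j \<and> v l < v j} = ?L \<union> ?M" using lt by blast
  also have "{l. i < l \<and> l < j \<and> v i < v l} = ?H \<union> ?M" using gt by blast
  finally have Ivt: "I ?v \<inter> E = insert (i, j) (Pair i ` (?L \<union> ?M) \<union> (\<lambda>l. (l, j)) ` (?H \<union> ?M))" .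
  have "card (I v \<inter> E) = card (Pair i ` ?L) + card ((\<lambda>l. (l, j)) ` ?H)"
    unfolding Iv by (rule card_Un_disjoint) auto
  then have 1: "card (I v \<inter> E) = card ?L + card ?H"
    by (simp add: card_image inj_on_def)
  have "card (I ?v \<inter> E) = Suc (card (Pair i ` (?L \<union> ?M) \<union> (\<lambda>l. (l, j)) ` (?H \<union> ?M)))"
    unfolding Ivt by (rule card_insert_disjoint) auto
  also have "card (Pair i ` (?L \<union> ?M) \<union> (\<lambda>l. (l, j)) ` (?H \<union> ?M))
      = card (Pair i ` (?L \<union> ?M)) + card ((\<lambda>l. (l, j)) ` (?H \<union> ?M))"
    by (rule card_Un_disjoint) auto
  also have "card (Pair i ` (?L \<union> ?M)) = card (?L \<union> ?M)"
    by (rule card_image) (simp add: inj_on_def)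
  also have "card ((\<lambda>l. (l, j)) ` (?H \<union> ?M)) = card (?H \<union> ?M)"
    by (rule card_image) (simp add: inj_on_def)
  also have "card (?L \<union> ?M) = card ?L + card ?M"
    by (rule card_Un_disjoint) auto
  also have "card (?H \<union> ?M) = card ?H + card ?M"
    by (rule card_Un_disjoint) auto
  finally have 2: "card (I ?v \<inter> E) = card (I v \<inter> E) + 1 + 2 * card ?M"
    using 1 by linarith
  have split: "card (I v) = card (I v \<inter> E) + card (I v - E)" for v
    using card_Int_Diff[OF finI] .
  show ?thesis
    using 2 off split[of v] split[of ?v] by (simp add: I_def perm_length_def t_def)
qed

lemma transpose_permutes:
  assumes "v permutes {1..n}" "1 \<le> i" "i \<le> n" "1 \<le> j" "j \<le> n"
  shows "(v \<circ> transpose i j) permutes {1..n}"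
  using assms by (auto intro!: permutes_compose permutes_swap_id)

lemma permutes_eq_iff:
  assumes "v permutes A"
  shows "v a = v b \<longleftrightarrow> a = b"
  using permutes_inj[OF assms] by (auto dest: injD)

lemma perm_length_less_iff:
  assumes v: "v permutes {1..n}" and ij: "1 \<le> i" "i < j" "j \<le> n"
  shows "perm_length n v < perm_length n (v \<circ> transpose i j) \<longleftrightarrow> v i < v j"
proof (cases "v i < v j")
  case True
  then show ?thesis
    using perm_length_transpose[OF v ij] by simp
next
  case False
  then have "v j < v i"
    using permutes_eq_iff[OF v, of i j] ij by simp
  moreover have "(v \<circ> transpose i j) permutes {1..n}"
    using v ij by (intro transpose_permutes) auto
  ultimately have "perm_length n (v \<circ> transpose i j) < perm_length n v"
    using perm_length_transpose[of "v \<circ> transpose i j" n i j] ij by (simp add: comp_assoc)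
  with False show ?thesis
    by simp
qed

lemma perm_length_cover_iff:
  assumes v: "v permutes {1..n}" and ij: "1 \<le> i" "i < j" "j \<le> n"
  shows "perm_length n (v \<circ> transpose i j) = Suc (perm_length n v) \<longleftrightarrow>
    v i < v j \<and> (\<forall>l. i < l \<and> l < j \<longrightarrow> \<not> (v i < v l \<and> v l < v j))"
proof (cases "v i < v j")
  case True
  have "finite {l. i < l \<and> l < j \<and> v i < v l \<and> v l < v j}"
    by (rule finite_subset[of _ "{i<..<j}"]) auto
  then show ?thesis
    using True perm_length_transpose[OF v ij True] by auto
next
  case False
  then show ?thesis
    using perm_length_less_iff[OF v ij] by auto
qed

lemma transpose_conj:
  "transpose a b \<circ> transpose c d \<circ> transpose a b
    = transpose (transpose a b c) (transpose a b d)"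
  by (auto simp: fun_eq_iff transpose_def)

section \<open>Labelled steps and walks of the k-Bruhat order\<close>

definition act :: "(nat \<Rightarrow> nat) \<Rightarrow> nat \<times> nat \<Rightarrow> nat \<Rightarrow> nat" where
  "act x t = x \<circ> transpose (fst t) (snd t)"

lemma act_apply: "act x (i, j) l = (if l = i then x j else if l = j then x i else x l)"
  by (simp add: act_def transpose_def)

context
  fixes n k :: nat
begin

text \<open>This is the k-Bruhat cover with label \<open>t\<close>, phrased through length so that
  it can be verified by counting; \<open>k_bruhat_cover_iff\<close> matches it with the
  order-theoretic cover.\<close>

definition kstep :: "(nat \<Rightarrow> nat) \<Rightarrow> nat \<times> nat \<Rightarrow> bool" where
  "kstep x t \<longleftrightarrow> x permutes {1..n} \<and> 1 \<le> fst t \<and> fst t \<le> k \<and> k < snd t \<and> snd t \<le> n \<and>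
    perm_length n (act x t) = Suc (perm_length n x)"

fun walk :: "(nat \<Rightarrow> nat) \<Rightarrow> (nat \<times> nat) list \<Rightarrow> (nat \<Rightarrow> nat) \<Rightarrow> bool" where
  "walk x [] y \<longleftrightarrow> y = x"
| "walk x (t # ts) y \<longleftrightarrow> kstep x t \<and> walk (act x t) ts y"

fun img :: "(nat \<Rightarrow> nat) \<Rightarrow> (nat \<times> nat) list \<Rightarrow> nat set set" where
  "img x [] = {sigma k x}"
| "img x (t # ts) = insert (sigma k x) (img (act x t) ts)"

text \<open>Right multiplication by such a transposition is invisible to \<open>sigma k\<close>, so
  these are the factors that may be moved along a walk without disturbing its image.\<close>

definition same_side :: "nat \<Rightarrow> nat \<Rightarrow> bool" where
  "same_side a b \<longleftrightarrow> 1 \<le> a \<and> a < b \<and> b \<le> n \<and> (b \<le> k \<or> k < a)"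

lemma kstepD:
  assumes "kstep x (i, j)"
  shows "x permutes {1..n}" "1 \<le> i" "i \<le> k" "k < j" "j \<le> n" "x i < x j"
    "perm_length n (act x (i, j)) = Suc (perm_length n x)"
    "\<And>l. i < l \<Longrightarrow> l < j \<Longrightarrow> x i < x l \<Longrightarrow> x l < x j \<Longrightarrow> False"
    "act x (i, j) permutes {1..n}"
  using assms perm_length_cover_iff[of x n i j] transpose_permutes[of x n i j]
  by (auto simp: kstep_def act_def)

lemma kstepI:
  assumes "x permutes {1..n}" "1 \<le> i" "i \<le> k" "k < j" "j \<le> n"
    "perm_length n (act x (i, j)) = Suc (perm_length n x)"
  shows "kstep x (i, j)"
  using assms by (simp add: kstep_def)

lemma kstep_permutes: "kstep x t \<Longrightarrow> act x t permutes {1..n}"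
  by (cases t) (auto dest: kstepD)

lemma walk_append: "walk x (ts @ ss) z \<longleftrightarrow> (\<exists>y. walk x ts y \<and> walk y ss z)"
  by (induction ts arbitrary: x) auto

lemma walk_permutes: "walk x ts y \<Longrightarrow> x permutes {1..n} \<Longrightarrow> y permutes {1..n}"
  by (induction ts arbitrary: x) (auto dest: kstep_permutes)

lemma walk_fun: "walk x ts y \<Longrightarrow> walk x ts z \<Longrightarrow> y = z"
  by (induction ts arbitrary: x) auto

lemma img_append: "walk x ts y \<Longrightarrow> img x (ts @ ss) = img x ts \<union> img y ss"
  by (induction ts arbitrary: x) (cases ss; auto)+

lemma end_in_img: "walk x ts y \<Longrightarrow> sigma k y \<in> img x ts"
  by (induction ts arbitrary: x) auto

lemma walk_length: "walk x ts y \<Longrightarrow> perm_length n y = perm_length n x + length ts"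
  by (induction ts arbitrary: x) (auto simp: kstep_def)

lemma kstep_mono:
  assumes "kstep x t" "l \<le> k"
  shows "x l \<le> act x t l"
  using assms kstepD(3,4,6)[of x "fst t" "snd t"] act_apply[of x "fst t" "snd t" l] by auto

lemma walk_mono: "walk x ts y \<Longrightarrow> l \<le> k \<Longrightarrow> x l \<le> y l"
  by (induction ts arbitrary: x) (auto dest: kstep_mono intro: order.trans)

text \<open>A step raises one entry up to \<open>k\<close> and lowers one entry beyond. It could
  invert \<open>a\<close> and \<open>b\<close> only by raising \<open>a\<close> past
  \<open>b\<close> or lowering \<open>b\<close> past \<open>a\<close>, and then the untouched
  position would lie between the two exchanged ones with an intermediate value, against the cover
  condition.\<close>

lemma kstep_same_side:
  assumes s: "kstep x t" and ab: "same_side a b" "x a < x b"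
  shows "act x t a < act x t b"
proof (cases t)
  case (Pair i j)
  note d = kstepD[OF s[unfolded Pair]]
  have inj: "x p = x q \<longleftrightarrow> p = q" for p q
    using permutes_eq_iff[OF d(1)] .
  show ?thesis
  proof (cases "b \<le> k")
    case True
    have "\<not> x b < x j" if "a = i"
      using d(8)[of b] that ab True d(4) by (auto simp: same_side_def)
    with True show ?thesis
      using ab d inj[of b j] by (auto simp: Pair act_apply same_side_def)
  next
    case False
    have "\<not> x i < x a" if "b = j"
      using d(8)[of a] that ab False d(3) by (auto simp: same_side_def)
    with False show ?thesis
      using ab d inj[of i a] by (auto simp: Pair act_apply same_side_def)
  qed
qed

lemma walk_same_side: "walk x ts y \<Longrightarrow> same_side a b \<Longrightarrow> x a < x b \<Longrightarrow> y a < y b"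
  by (induction ts arbitrary: x) (auto dest: kstep_same_side)

lemma walk_same_side_iff:
  assumes "walk x ts y" "x permutes {1..n}" "same_side a b" "y b < y a"
  shows "x b < x a"
proof -
  have "x a \<noteq> x b"
    using permutes_eq_iff[OF assms(2)] assms(3) by (auto simp: same_side_def)
  then show ?thesis
    using walk_same_side[OF assms(1,3)] assms(4) by fastforce
qed

lemma sum_sigma:
  assumes "x permutes {1..n}"
  shows "\<Sum>(sigma k x) = (\<Sum>i = 1..k. x i)"
  unfolding sigma_def by (rule sum.reindex_cong[OF permutes_inj_on[OF assms]]) auto

text \<open>The entries at positions up to \<open>k\<close> never drop and the one at
  \<open>fst t\<close> grows. The sum of the k-subset is therefore a rank-like quantity that depends
  on the image alone and separates the images of the vertices of a walk.\<close>

lemma kstep_sum_sigma: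
  assumes "kstep x t"
  shows "\<Sum>(sigma k x) < \<Sum>(sigma k (act x t))"
proof (cases t)
  case (Pair i j)
  note d = kstepD[OF assms[unfolded Pair]]
  have "(\<Sum>i = 1..k. x i) < (\<Sum>i = 1..k. act x t i)"
  proof (rule sum_strict_mono_ex1)
    show "\<exists>l\<in>{1..k}. x l < act x t l"
      using d by (intro bexI[of _ i]) (auto simp: Pair act_apply)
  qed (use kstep_mono[OF assms] in auto)
  then show ?thesis
    using sum_sigma d(1) kstep_permutes[OF assms] by simp
qed

lemma img_sum_ge: "walk x ts y \<Longrightarrow> S \<in> img x ts \<Longrightarrow> \<Sum>(sigma k x) \<le> \<Sum>S"
proof (induction ts arbitrary: x)
  case (Cons t ts)
  show ?case
  proof (cases "S = sigma k x")
    case False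
    then have "\<Sum>(sigma k (act x t)) \<le> \<Sum>S"
      using Cons by auto
    then show ?thesis
      using kstep_sum_sigma[of x t] Cons.prems by simp
  qed simp
qed simp

lemma start_notin_img: "walk x (t # ts) y \<Longrightarrow> sigma k x \<notin> img (act x t) ts"
  using kstep_sum_sigma[of x t] img_sum_ge[of "act x t" ts y "sigma k x"] by fastforce

lemma finite_img: "finite (img x ts)"
  by (induction ts arbitrary: x) auto

text \<open>Growing sums keep the images of successive vertices distinct. All walks between two
  fixed ends thus have images of one cardinality.\<close>

lemma card_img: "walk x ts y \<Longrightarrow> card (img x ts) = Suc (length ts)"
proof (induction ts arbitrary: x)
  case (Cons t ts)
  then show ?case
    using start_notin_img[of x t ts y] by (simp add: finite_img)
qed simp

lemma sigma_same_side:
  assumes "same_side a b"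
  shows "sigma k (x \<circ> transpose a b) = sigma k x"
proof -
  have "transpose a b ` {1..k} = {1..k}"
    using assms by (cases "b \<le> k") (auto simp: same_side_def transpose_def image_iff)
  then show ?thesis
    by (metis image_comp sigma_def)
qed

lemma same_side_permutes:
  "x permutes {1..n} \<Longrightarrow> same_side a b \<Longrightarrow> (x \<circ> transpose a b) permutes {1..n}"
  by (intro transpose_permutes) (auto simp: same_side_def)

lemma same_side_length:
  assumes "x permutes {1..n}" "same_side a b"
  shows "perm_length n x < perm_length n (x \<circ> transpose a b) \<longleftrightarrow> x a < x b"
  using perm_length_less_iff[OF assms(1), of a b] assms(2) by (auto simp: same_side_def)

lemma act_length:
  assumes "x permutes {1..n}" "1 \<le> i" "i \<le> k" "k < j" "j \<le> n"
  shows "perm_length n x < perm_length n (act x (i, j)) \<longleftrightarrow> x i < x j"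
  using perm_length_less_iff[OF assms(1,2) _ assms(5)] assms by (simp add: act_def)

lemma act_permutes:
  assumes "x permutes {1..n}" "1 \<le> i" "i \<le> k" "k < j" "j \<le> n"
  shows "act x (i, j) permutes {1..n}"
  using transpose_permutes[OF assms(1), of i j] assms by (simp add: act_def)

end

section \<open>Same-side transpositions along a walk\<close>

context
  fixes n k :: nat
begin

lemma transpose_same_side:
  assumes "same_side n k a b" "1 \<le> i" "i \<le> k" "k < j" "j \<le> n"
  shows "1 \<le> transpose a b i" "transpose a b i \<le> k" "k < transpose a b j" "transpose a b j \<le> n"
  using assms by (auto simp: same_side_def transpose_def)

lemma act_conj:
  "act x (transpose a b i, transpose a b j) = act (x \<circ> transpose a b) (i, j) \<circ> transpose a b"
  unfolding act_def fst_conv snd_conv transpose_conj[symmetric] by (simp add: comp_assoc)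

lemma act_conj':
  "act x (transpose a b i, transpose a b j) \<circ> transpose a b = act (x \<circ> transpose a b) (i, j)"
  unfolding act_conj by (simp add: comp_assoc)

text \<open>The square closes by counting: \<open>x\<close>, \<open>act x t\<close> and the end of
  the given step rise strictly twice within a length difference of two, so both rises are
  covers.\<close>

lemma kstep_conj_up:
  assumes x: "x permutes {1..n}" and ab: "same_side n k a b"
    and l: "perm_length n (x \<circ> transpose a b) = Suc (perm_length n x)"
    and s: "kstep n k (x \<circ> transpose a b) (i, j)"
    and y: "act (x \<circ> transpose a b) (i, j) b < act (x \<circ> transpose a b) (i, j) a"
  defines "t \<equiv> (transpose a b i, transpose a b j)"
  shows "kstep n k x t" "act x t \<circ> transpose a b = act (x \<circ> transpose a b) (i, j)"
    "perm_length n (act x t \<circ> transpose a b) = Suc (perm_length n (act x t))"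
proof -
  let ?t = "transpose a b"
  note d = kstepD[OF s]
  note r = transpose_same_side[OF ab d(2-5)]
  show e: "act x t \<circ> ?t = act (x \<circ> ?t) (i, j)"
    unfolding t_def by (rule act_conj')
  have p: "act x t permutes {1..n}"
    using act_permutes[OF x r] by (simp add: t_def)
  have "act x t a < act x t b"
    using y unfolding e[symmetric] by simp
  then have "perm_length n (act x t) < perm_length n (act x t \<circ> ?t)"
    using same_side_length[OF p ab] by simp
  moreover have "perm_length n x < perm_length n (act x t)"
    using act_length[OF x r] d(6) by (simp add: t_def)
  moreover have "perm_length n (act x t \<circ> ?t) = Suc (Suc (perm_length n x))"
    using d(7) l e by simp
  ultimately show "kstep n k x t" "perm_length n (act x t \<circ> ?t) = Suc (perm_length n (act x t))"
    using x r by (auto simp: t_def intro!: kstepI)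
qed

text \<open>Here the conjugated step alone would land above the end. Instead the step itself
  followed by its conjugate reaches the same end, which trades the same-side cover for a second
  k-Bruhat step; two strict rises again fill the length difference of two.\<close>

lemma kstep_resolve_up:
  assumes x: "x permutes {1..n}" and ab: "same_side n k a b"
    and l: "perm_length n (x \<circ> transpose a b) = Suc (perm_length n x)"
    and s: "kstep n k (x \<circ> transpose a b) (i, j)"
    and y: "act (x \<circ> transpose a b) (i, j) a < act (x \<circ> transpose a b) (i, j) b"
  defines "t \<equiv> (transpose a b i, transpose a b j)"
  shows "kstep n k x (i, j)" "kstep n k (act x (i, j)) t"
    "act (act x (i, j)) t = act (x \<circ> transpose a b) (i, j)"
proof -
  let ?t = "transpose a b"
  note d = kstepD[OF s]
  note r = transpose_same_side[OF ab d(2-5)]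
  have xab: "x a < x b"
    using same_side_length[OF x ab] l by simp
  \<comment> \<open>A step raises entries up to \<open>k\<close> and lowers those beyond, so the
    inversion of \<open>a\<close> and \<open>b\<close> can be undone only by raising the entry at
    \<open>b\<close> or by lowering the entry at \<open>a\<close>.\<close>
  have cases: "b \<le> k \<and> i = b \<or> k < a \<and> j = a"
    using y xab d(3-6) ab by (auto simp: act_apply same_side_def split: if_splits)
  show e: "act (act x (i, j)) t = act (x \<circ> ?t) (i, j)"
    using cases ab d(3,4) by (auto simp: t_def act_def transpose_def fun_eq_iff same_side_def)
  have p: "act x (i, j) permutes {1..n}"
    by (rule act_permutes[OF x d(2-5)])
  have "x i < x j"
    using cases d(3,4,6) ab xab y
    by (auto simp: act_apply transpose_def same_side_def split: if_splits)
  then have "perm_length n x < perm_length n (act x (i, j))"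
    using act_length[OF x d(2-5)] by simp
  moreover have "act x (i, j) (?t i) < act x (i, j) (?t j)"
    using cases d(3,4,6) ab xab by (auto simp: act_apply transpose_def same_side_def split: if_splits)
  then have "perm_length n (act x (i, j)) < perm_length n (act (act x (i, j)) t)"
    using act_length[OF p r] by (simp add: t_def)
  moreover have "perm_length n (act (act x (i, j)) t) = Suc (Suc (perm_length n x))"
    using d(7) l e by simp
  ultimately show "kstep n k x (i, j)" "kstep n k (act x (i, j)) t"
    using x r p d(2-5) by (auto simp: t_def intro!: kstepI)
qed

text \<open>The transposition is moved past one step at a time. Either every square closes and it
  survives below the end \<open>y\<close>, or the first step that undoes the inversion swallows it;
  no later step inverts \<open>a\<close> and \<open>b\<close> again, so the order of
  \<open>y a\<close> and \<open>y b\<close> tells which case occurred.\<close>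

lemma walk_conj_up:
  assumes "walk n k (x \<circ> transpose a b) ts y" "x permutes {1..n}" "same_side n k a b"
    "perm_length n (x \<circ> transpose a b) = Suc (perm_length n x)"
  shows "y b < y a \<and> perm_length n y = Suc (perm_length n (y \<circ> transpose a b)) \<and>
      (\<exists>ts'. walk n k x ts' (y \<circ> transpose a b) \<and> img k x ts' = img k (x \<circ> transpose a b) ts) \<or>
    y a < y b \<and> (\<exists>ts'. walk n k x ts' y \<and> img k (x \<circ> transpose a b) ts \<subseteq> img k x ts')"
  using assms
proof (induction ts arbitrary: x)
  case Nil
  have y: "y = x \<circ> transpose a b"
    using Nil(1) unfolding walk.simps .
  have yx: "y \<circ> transpose a b = x"
    unfolding y by (simp add: comp_assoc)
  have "x a < x b"
    using same_side_length[OF Nil(2,3)] Nil(4) by linarith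
  have "y b < y a"
    using \<open>x a < x b\<close> unfolding y by simp
  moreover have "perm_length n y = Suc (perm_length n (y \<circ> transpose a b))"
    unfolding yx unfolding y by (rule Nil)
  moreover have "walk n k x [] (y \<circ> transpose a b)"
    unfolding yx by simp
  moreover have "img k x [] = img k (x \<circ> transpose a b) []"
    using sigma_same_side[OF Nil(3), of x] unfolding img.simps by simp
  ultimately show ?case
    by blast
next
  case (Cons t ts)
  let ?t = "transpose a b"
  obtain i j where t: "t = (i, j)"
    by (cases t)
  let ?z = "act (x \<circ> ?t) (i, j)"
  have s: "kstep n k (x \<circ> ?t) (i, j)" and w: "walk n k ?z ts y"
    using Cons.prems(1) unfolding t walk.simps by blast+
  have z: "?z permutes {1..n}"
    using s by (rule kstepD)
  have sx: "sigma k (x \<circ> ?t) = sigma k x"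
    by (rule sigma_same_side[OF Cons.prems(3)])
  consider "?z b < ?z a" | "?z a < ?z b"
    using permutes_eq_iff[OF z, of a b] Cons.prems(3) by (force simp: same_side_def)
  then show ?case
  proof cases
    case 1
    note u = kstep_conj_up[OF Cons.prems(2-4) s 1]
    define r where "r = (?t i, ?t j)"
    have "walk n k (act x r \<circ> ?t) ts y"
      using w u(2) by (simp add: r_def)
    note IH = Cons.IH[OF this kstep_permutes[OF u(1)[folded r_def]] Cons.prems(3) u(3)[folded r_def]]
    from IH show ?thesis
    proof (elim disjE conjE exE)
      fix ts'
      assume *: "y b < y a" "perm_length n y = Suc (perm_length n (y \<circ> ?t))"
        "walk n k (act x r) ts' (y \<circ> ?t)" "img k (act x r) ts' = img k (act x r \<circ> ?t) ts"
      have "walk n k x (r # ts') (y \<circ> ?t)"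
        using * u(1) by (simp add: r_def)
      moreover have "img k x (r # ts') = img k (x \<circ> ?t) (t # ts)"
        using * u(2) sx by (simp add: r_def t)
      ultimately show ?thesis
        using * by blast
    next
      fix ts'
      assume *: "y a < y b" "walk n k (act x r) ts' y"
        "img k (act x r \<circ> ?t) ts \<subseteq> img k (act x r) ts'"
      have "walk n k x (r # ts') y"
        using * u(1) by (simp add: r_def)
      moreover have "img k (x \<circ> ?t) (t # ts) \<subseteq> img k x (r # ts')"
        using * u(2) sx by (auto simp: r_def t)
      ultimately show ?thesis
        using * by blast
    qed
  next
    case 2
    note u = kstep_resolve_up[OF Cons.prems(2-4) s 2]
    define r where "r = (?t i, ?t j)"
    have "walk n k x (t # r # ts) y"
      using w u by (simp add: r_def t)
    moreover have "img k (x \<circ> ?t) (t # ts) \<subseteq> img k x (t # r # ts)"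
      using u(3) sx by (auto simp: r_def t)
    moreover have "y a < y b"
      by (rule walk_same_side[OF w Cons.prems(3) 2])
    ultimately show ?thesis
      by blast
  qed
qed

text \<open>This is the square of \<open>kstep_conj_up\<close> completed from above:
  \<open>x\<close>, \<open>x \<circ> transpose a b\<close> and the top rise strictly twice within a
  length difference of two.\<close>

lemma kstep_conj_down:
  assumes s: "kstep n k x (i, j)" and ab: "same_side n k a b"
    and l: "perm_length n (act x (i, j) \<circ> transpose a b) = Suc (perm_length n (act x (i, j)))"
    and y: "x a < x b"
  defines "t \<equiv> (transpose a b i, transpose a b j)"
  shows "kstep n k (x \<circ> transpose a b) t"
    "act (x \<circ> transpose a b) t = act x (i, j) \<circ> transpose a b"
    "perm_length n (x \<circ> transpose a b) = Suc (perm_length n x)"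
proof -
  let ?t = "transpose a b"
  note d = kstepD[OF s]
  note r = transpose_same_side[OF ab d(2-5)]
  show e: "act (x \<circ> ?t) t = act x (i, j) \<circ> ?t"
    unfolding t_def act_conj by (simp add: comp_assoc)
  have p: "(x \<circ> ?t) permutes {1..n}"
    by (rule same_side_permutes[OF d(1) ab])
  have "perm_length n x < perm_length n (x \<circ> ?t)"
    using same_side_length[OF d(1) ab] y by simp
  moreover have "perm_length n (x \<circ> ?t) < perm_length n (act (x \<circ> ?t) t)"
    using act_length[OF p r] d(6) by (simp add: t_def)
  moreover have "perm_length n (act (x \<circ> ?t) t) = Suc (Suc (perm_length n x))"
    using d(7) l e by simp
  ultimately show "kstep n k (x \<circ> ?t) t" "perm_length n (x \<circ> ?t) = Suc (perm_length n x)"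
    using p r by (auto simp: t_def intro!: kstepI)
qed

text \<open>The step removes the inversion that multiplication by \<open>(a b)\<close> restores.
  Taking the conjugated step first and the original label second reaches the same top by two
  k-Bruhat steps.\<close>

lemma kstep_resolve_down:
  assumes s: "kstep n k x (i, j)" and ab: "same_side n k a b"
    and l: "perm_length n (act x (i, j) \<circ> transpose a b) = Suc (perm_length n (act x (i, j)))"
    and y: "x b < x a"
  defines "t \<equiv> (transpose a b i, transpose a b j)"
  shows "kstep n k x t" "kstep n k (act x t) (i, j)"
    "act (act x t) (i, j) = act x (i, j) \<circ> transpose a b"
proof -
  let ?t = "transpose a b"
  note d = kstepD[OF s]
  note r = transpose_same_side[OF ab d(2-5)]
  have yab: "act x (i, j) a < act x (i, j) b"
    using same_side_length[OF d(9) ab] l by simp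
  have cases: "b \<le> k \<and> i = b \<or> k < a \<and> j = a"
    using y yab d(3-6) ab by (auto simp: act_apply same_side_def split: if_splits)
  show e: "act (act x t) (i, j) = act x (i, j) \<circ> ?t"
    using cases ab d(3,4) by (auto simp: t_def act_def transpose_def fun_eq_iff same_side_def)
  have p: "act x t permutes {1..n}"
    using act_permutes[OF d(1) r] by (simp add: t_def)
  have "x (?t i) < x (?t j)"
    using cases d(3,4,6) ab y yab
    by (auto simp: act_apply transpose_def same_side_def split: if_splits)
  then have "perm_length n x < perm_length n (act x t)"
    using act_length[OF d(1) r] by (simp add: t_def)
  moreover have "act x t i < act x t j"
    using cases d(3,4,6) ab y yab
    by (auto simp: t_def act_apply transpose_def same_side_def split: if_splits)
  then have "perm_length n (act x t) < perm_length n (act (act x t) (i, j))"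
    using act_length[OF p d(2-5)] by simp
  moreover have "perm_length n (act (act x t) (i, j)) = Suc (Suc (perm_length n x))"
    using d(7) l e by simp
  ultimately show "kstep n k x t" "kstep n k (act x t) (i, j)"
    using d(1-5) r p by (auto simp: t_def intro!: kstepI)
qed

text \<open>The transposition is moved from the end towards \<open>u\<close>. It cannot arrive
  there, because \<open>u\<close> already inverts \<open>a\<close> and \<open>b\<close> and would
  not become longer, so some step on the way absorbs it.\<close>

lemma walk_absorb_down:
  assumes "walk n k u ts x" "u permutes {1..n}" "same_side n k a b" "u b < u a"
    "perm_length n (x \<circ> transpose a b) = Suc (perm_length n x)"
  shows "\<exists>ts'. walk n k u ts' (x \<circ> transpose a b) \<and> img k u ts \<subseteq> img k u ts'"
  using assms
proof (induction ts arbitrary: x rule: rev_induct)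
  case Nil
  then show ?case
    using same_side_length[of u n k a b] by (metis lessI less_asym walk.simps(1))
next
  case (snoc t ts)
  let ?t = "transpose a b"
  obtain i j where t: "t = (i, j)"
    by (cases t)
  obtain z where w: "walk n k u ts z" and s: "kstep n k z (i, j)" and x: "x = act z (i, j)"
    using snoc.prems(1) t by (auto simp: walk_append)
  note l = snoc.prems(5)[unfolded x]
  have z: "z permutes {1..n}"
    using s by (rule kstepD)
  have sx: "sigma k (x \<circ> ?t) = sigma k x"
    by (rule sigma_same_side[OF snoc.prems(3)])
  define r where "r = (?t i, ?t j)"
  have im: "img k u (ts @ [t]) = img k u ts \<union> {sigma k z, sigma k x}"
    using img_append[OF w, of "[t]"] by (simp add: x t)
  consider "z b < z a" | "z a < z b"
    using permutes_eq_iff[OF z, of a b] snoc.prems(3) by (force simp: same_side_def)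
  then show ?case
  proof cases
    case 1
    note v = kstep_resolve_down[OF s snoc.prems(3) l 1]
    have "walk n k u (ts @ [r, t]) (x \<circ> ?t)"
      using w v by (auto simp: walk_append r_def t x)
    moreover have "img k u (ts @ [t]) \<subseteq> img k u (ts @ [r, t])"
      using im img_append[OF w, of "[r, t]"] v(3) sx by (auto simp: r_def t x)
    ultimately show ?thesis
      by blast
  next
    case 2
    note v = kstep_conj_down[OF s snoc.prems(3) l 2]
    from snoc.IH[OF w snoc.prems(2-4) v(3)] obtain ts' where
      *: "walk n k u ts' (z \<circ> ?t)" "img k u ts \<subseteq> img k u ts'"
      by blast
    have "walk n k u (ts' @ [r]) (x \<circ> ?t)"
      using * v by (auto simp: walk_append r_def x)
    moreover have "img k u (ts @ [t]) \<subseteq> img k u (ts' @ [r])"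
      using im img_append[OF *(1), of "[r]"] *(2) v(2) sx
        sigma_same_side[OF snoc.prems(3), of z] by (auto simp: r_def x)
    ultimately show ?thesis
      by blast
  qed
qed

end

section \<open>Descents and increasing walks\<close>

lemma label_less_trans:
  "label_less w a b \<Longrightarrow> label_less w b c \<Longrightarrow> label_less w a c"
  by (auto simp: label_less_def split: prod.splits)

lemma label_less_irrefl: "\<not> label_less w a a"
  by (auto simp: label_less_def split: prod.splits)

lemma label_less_total:
  assumes "w permutes {1..n}"
  shows "a = b \<or> label_less w a b \<or> label_less w b a"
  using permutes_eq_iff[OF assms]
  by (cases a; cases b) (simp add: label_less_def, metis linorder_neqE_nat)

context
  fixes n k :: nat
begin

text \<open>Disjoint transpositions commute and both exchanges still increase the length in the
  other order; two rises inside a difference of two are covers.\<close>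

lemma kstep_commute:
  assumes s: "kstep n k x (a, b)" and s': "kstep n k (act x (a, b)) (c, d)"
    and ne: "a \<noteq> c" "b \<noteq> d"
  shows "kstep n k x (c, d)" "kstep n k (act x (c, d)) (a, b)"
    "act (act x (c, d)) (a, b) = act (act x (a, b)) (c, d)"
proof -
  note p = kstepD[OF s] and q = kstepD[OF s']
  show e: "act (act x (c, d)) (a, b) = act (act x (a, b)) (c, d)"
    using ne p(3,4) q(3,4) by (auto simp: fun_eq_iff act_apply)
  have m: "act x (c, d) permutes {1..n}"
    by (rule act_permutes[OF p(1) q(2-5)])
  have "x c < x d"
    using q(6) ne p(3,4) q(3,4) by (auto simp: act_apply split: if_splits)
  then have "perm_length n x < perm_length n (act x (c, d))"
    using act_length[OF p(1) q(2-5)] by simp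
  moreover have "act x (c, d) a < act x (c, d) b"
    using p(6) ne p(3,4) q(3,4) by (auto simp: act_apply split: if_splits)
  then have "perm_length n (act x (c, d)) < perm_length n (act (act x (c, d)) (a, b))"
    using act_length[OF m p(2-5)] by simp
  moreover have "perm_length n (act (act x (c, d)) (a, b)) = Suc (Suc (perm_length n x))"
    unfolding e using p(7) q(7) by simp
  ultimately show "kstep n k x (c, d)" "kstep n k (act x (c, d)) (a, b)"
    using p(1-5) q(2-5) m by (auto intro!: kstepI)
qed

text \<open>
  A descent whose two labels share an index has no alternative midpoint in the k-Bruhat order:
  the other midpoint \<open>x (c d)\<close> lies one same-side transposition \<open>(p q)\<close> below the top.
\<close>

lemma kstep_reroute:
  assumes z: "z permutes {1..n}" and x: "x permutes {1..n}"
    and cd: "1 \<le> c" "c \<le> k" "k < d" "d \<le> n" "x c < x d"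
    and pq: "same_side n k p q" "act x (c, d) p < act x (c, d) q"
    and e: "act x (c, d) \<circ> transpose p q = z"
    and l: "perm_length n z = Suc (Suc (perm_length n x))"
    and r: "walk n k z rs w" "w p < w q"
  shows "\<exists>ts. walk n k x ((c, d) # ts) w \<and> img k z rs \<subseteq> img k x ((c, d) # ts)"
proof -
  have m: "act x (c, d) permutes {1..n}"
    by (rule act_permutes[OF x cd(1-4)])
  have "perm_length n x < perm_length n (act x (c, d))"
    using act_length[OF x cd(1-4)] cd(5) by simp
  moreover have "perm_length n (act x (c, d)) < perm_length n z"
    using same_side_length[OF m pq(1)] pq(2) unfolding e by simp
  ultimately have l1: "perm_length n (act x (c, d)) = Suc (perm_length n x)"
    and l2: "perm_length n z = Suc (perm_length n (act x (c, d)))"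
    using l by auto
  have s: "kstep n k x (c, d)"
    using x cd l1 by (intro kstepI)
  \<comment> \<open>The factor \<open>(p q)\<close> below \<open>z\<close> is carried up along
    \<open>rs\<close>. Since \<open>w p < w q\<close>, it must be absorbed before reaching
    \<open>w\<close>, which gives a walk ending at \<open>w\<close> itself.\<close>
  from walk_conj_up[of n k "act x (c, d)" p q rs w] r(1) m pq(1) l2 r(2)
  obtain ts where "walk n k (act x (c, d)) ts w" "img k z rs \<subseteq> img k (act x (c, d)) ts"
    unfolding e by (metis less_asym)
  with s show ?thesis
    by (intro exI[of _ ts]) auto
qed

text \<open>With disjoint labels the two steps are exchanged. With a common index, the comparison in
  \<open>w\<close> forces the order of the two remaining positions, and the smaller label
  \<open>t'\<close> taken first leaves a same-side factor that \<open>kstep_reroute\<close> absorbs.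
  In every case only the image of the vertex \<open>act x t\<close> may be lost.\<close>

lemma descent_exchange:
  assumes s: "kstep n k x t" and s': "kstep n k (act x t) t'"
    and r: "walk n k (act (act x t) t') rs w"
    and nl: "\<not> label_less w t t'"
  shows "\<exists>s ts. label_less w s t \<and> walk n k x (s # ts) w \<and>
    img k (act (act x t) t') rs \<subseteq> img k x (s # ts)"
proof -
  obtain a b c d where t: "t = (a, b)" and t': "t' = (c, d)"
    by (cases t, cases t')
  let ?z = "act (act x t) t'"
  note p = kstepD[OF s[unfolded t]] and q = kstepD[OF s'[unfolded t t']]
  have z: "?z permutes {1..n}" and w: "w permutes {1..n}"
    using kstep_permutes[OF s'] walk_permutes[OF r] by auto
  have inj: "x i = x j \<longleftrightarrow> i = j" for i j
    using permutes_eq_iff[OF p(1)] .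
  have winj: "w i = w j \<longleftrightarrow> i = j" for i j
    using permutes_eq_iff[OF w] .
  have l: "perm_length n ?z = Suc (Suc (perm_length n x))"
    using p(7) q(7) by (simp add: t t')
  have ne: "t \<noteq> t'"
    using p(3,4,6) q(6) by (auto simp: act_apply t t' split: if_splits)
  with nl have lt: "label_less w t' t"
    using label_less_total[OF w] by blast
  consider "a \<noteq> c" "b \<noteq> d" | "a = c" "b \<noteq> d" | "b = d" "a \<noteq> c"
    using ne t t' by blast
  then show ?thesis
  proof cases
    case 1
    note u = kstep_commute[OF s[unfolded t] s'[unfolded t t'] 1]
    have "walk n k x (t' # t # rs) w"
      using u r by (simp add: t t')
    moreover have "img k ?z rs \<subseteq> img k x (t' # t # rs)"
      using u by (auto simp: t t')
    ultimately show ?thesis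
      using lt by blast
  next
    case 2
    have wdb: "w d < w b"
      using lt 2 by (simp add: label_less_def t t')
    have z_apply: "?z b = x a" "?z d = x b"
      using 2 p(3,4) q(3,4) by (auto simp: act_apply t t')
    have xs: "x a < x b" "x b < x d"
      using p(6) q(6) 2 p(3,4) q(3,4) by (auto simp: act_apply t t' split: if_splits)
    \<comment> \<open>Otherwise \<open>b\<close> and \<open>d\<close> form a same-side pair that is
      not inverted in \<open>?z\<close>, and the walk to \<open>w\<close> would keep it so, against
      \<open>wdb\<close>.\<close>
    have "d < b"
    proof (rule ccontr)
      assume "\<not> d < b"
      then have "same_side n k b d"
        using 2 p(4) q(5) by (auto simp: same_side_def)
      from walk_same_side[OF r this] z_apply xs wdb show False
        by simp
    qed
    then have ss: "same_side n k d b"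
      using p(4,5) q(4) by (auto simp: same_side_def)
    have "\<exists>ts. walk n k x ((c, d) # ts) w \<and> img k ?z rs \<subseteq> img k x ((c, d) # ts)"
    proof (rule kstep_reroute[OF z p(1) q(2-5) _ ss _ _ l r wdb])
      show "act x (c, d) \<circ> transpose d b = ?z"
        using 2 p(3,4) q(3,4) by (auto simp: act_apply t t' transpose_def fun_eq_iff)
    qed (use 2 xs p(3,4) q(3,4) in \<open>auto simp: act_apply\<close>)
    with lt show ?thesis
      unfolding t' by blast
  next
    case 3
    have wac: "w a < w c"
      using lt 3 by (simp add: label_less_def t t')
    have z_apply: "?z a = x b" "?z c = x a"
      using 3 p(3,4) q(3,4) by (auto simp: act_apply t t')
    have xs: "x a < x b" "x c < x a"
      using p(6) q(6) 3 p(3,4) q(3,4) by (auto simp: act_apply t t' split: if_splits)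
    have "a < c"
    proof (rule ccontr)
      assume "\<not> a < c"
      then have "same_side n k c a"
        using 3 p(3-5) q(2) by (auto simp: same_side_def)
      from walk_same_side[OF r this] z_apply xs wac show False
        by simp
    qed
    then have ss: "same_side n k a c"
      using p(2,4,5) q(3) by (auto simp: same_side_def)
    have "\<exists>ts. walk n k x ((c, d) # ts) w \<and> img k ?z rs \<subseteq> img k x ((c, d) # ts)"
    proof (rule kstep_reroute[OF z p(1) q(2-5) _ ss _ _ l r wac])
      show "act x (c, d) \<circ> transpose a c = ?z"
        using 3 p(3,4) q(3,4) by (auto simp: act_apply t t' transpose_def fun_eq_iff)
    qed (use 3 xs p(3,4) q(3,4) in \<open>auto simp: act_apply\<close>)
    with lt show ?thesis
      unfolding t' by blast
  qed
qed

section \<open>Walks with increasing labels\<close>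

lemma walk_unmoved:
  "walk n k x ts y \<Longrightarrow> l \<notin> fst ` set ts \<Longrightarrow> l \<notin> snd ` set ts \<Longrightarrow> y l = x l"
  by (induction ts arbitrary: x) (auto simp: act_apply)

lemma walk_sides: "walk n k x ts y \<Longrightarrow> t \<in> set ts \<Longrightarrow> fst t \<le> k \<and> k < snd t"
  by (induction ts arbitrary: x) (auto simp: kstep_def)

text \<open>If a step \<open>(e, j)\<close> lifted position \<open>e\<close> beyond
  \<open>x f\<close>, the cover condition would put \<open>j\<close> before \<open>f\<close>. The
  step leaves \<open>x e\<close> at \<open>j\<close>, below the entry at \<open>f\<close>, and this
  same-side order persists to \<open>w\<close>, contradicting \<open>w f < w j\<close>.\<close>

lemma walk_same_first_bound:
  assumes "walk n k x ts y" "walk n k y rs w" "\<forall>t\<in>set ts. fst t = e \<and> w f < w (snd t)"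
    "x e < x f" "e \<le> k" "k < f" "f \<le> n"
  shows "y e < y f \<and> y f = x f"
  using assms
proof (induction ts arbitrary: x)
  case (Cons t ts)
  obtain j where t: "t = (e, j)"
    using Cons.prems(3) by (cases t) auto
  have s: "kstep n k x (e, j)" and w: "walk n k (act x (e, j)) ts y"
    using Cons.prems(1) t by auto
  note d = kstepD[OF s]
  have wj: "w f < w j"
    using Cons.prems(3) t by simp
  then have "f \<noteq> j"
    by auto
  have "x j < x f"
  proof (rule ccontr)
    assume "\<not> x j < x f"
    then have "x f < x j"
      using permutes_eq_iff[OF d(1), of f j] \<open>f \<noteq> j\<close> by simp
    then have "j < f"
      using d(8)[of f] Cons.prems(4-6) \<open>f \<noteq> j\<close>
      by (meson le_less_trans linorder_neqE_nat)
    then have ss: "same_side n k j f"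
      using d(4) Cons.prems(7) by (auto simp: same_side_def)
    have "act x (e, j) j < act x (e, j) f"
      using Cons.prems(4-6) d(4) \<open>f \<noteq> j\<close> by (auto simp: act_apply)
    from walk_same_side[OF Cons.prems(2) ss walk_same_side[OF w ss this]] wj show False
      by simp
  qed
  then have "act x (e, j) e < act x (e, j) f" and "act x (e, j) f = x f"
    using \<open>f \<noteq> j\<close> Cons.prems(5,6) by (auto simp: act_apply)
  with Cons.IH[OF w Cons.prems(2)] Cons.prems(3,5-7) show ?case
    by simp
qed simp

text \<open>Labels are ordered first by decreasing \<open>w\<close> of the first index. An
  increasing word above \<open>(e, f)\<close> therefore uses up all labels at \<open>e\<close>
  before passing for good to indices of smaller \<open>w\<close>.\<close>

lemma sorted_labels_split:
  assumes "sorted_wrt (label_less w) ts" "\<forall>t\<in>set ts. label_less w (e, f) t"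
  shows "\<exists>us vs. ts = us @ vs \<and> (\<forall>t\<in>set us. fst t = e \<and> w f < w (snd t)) \<and>
    (\<forall>t\<in>set vs. w (fst t) < w e)"
  using assms
proof (induction ts)
  case (Cons t ts)
  show ?case
  proof (cases "fst t = e")
    case True
    obtain us vs where *: "ts = us @ vs" "\<forall>t\<in>set us. fst t = e \<and> w f < w (snd t)"
      "\<forall>t\<in>set vs. w (fst t) < w e"
      using Cons by auto
    have "w f < w (snd t)"
      using Cons.prems(2) True by (auto simp: label_less_def split: prod.splits)
    with * True show ?thesis
      by (intro exI[of _ "t # us"] exI[of _ vs]) auto
  next
    case False
    then have "w (fst t) < w e"
      using Cons.prems(2) by (auto simp: label_less_def split: prod.splits)
    moreover have "w (fst s) \<le> w (fst t)" if "s \<in> set ts" for s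
    proof -
      have "label_less w t s"
        using Cons.prems(1) that by simp
      then show ?thesis
        by (cases t; cases s) (auto simp: label_less_def)
    qed
    ultimately have "\<forall>s\<in>set (t # ts). w (fst s) < w e"
      by fastforce
    then show ?thesis
      by (intro exI[of _ "[]"] exI[of _ "t # ts"]) simp
  qed
qed simp

text \<open>
  Along an increasing walk from \<open>v\<close> to \<open>y\<close>, no value on the first \<open>k\<close> positions crosses the
  level \<open>y e\<close>, whereas the competing walk lifts position \<open>e\<close> above that level.
\<close>

lemma increasing_walk_first:
  assumes v: "v permutes {1..n}" and ts: "walk n k v ts y" and rs: "walk n k y rs w"
    and sorted: "sorted_wrt (label_less w) ts"
    and less: "\<forall>t\<in>set ts. label_less w (e, f) t"
    and s: "kstep n k v (e, f)" and ds: "walk n k (act v (e, f)) ds y'"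
    and eq: "sigma k y' = sigma k y"
  shows False
proof -
  note d = kstepD[OF s]
  obtain us vs where split: "ts = us @ vs"
    "\<forall>t\<in>set us. fst t = e \<and> w f < w (snd t)" "\<forall>t\<in>set vs. w (fst t) < w e"
    using sorted_labels_split[OF sorted less] by blast
  obtain x where us: "walk n k v us x" and vs: "walk n k x vs y"
    using ts split(1) by (auto simp: walk_append)
  have xw: "walk n k x (vs @ rs) w"
    using vs rs by (auto simp: walk_append)
  have y: "y permutes {1..n}" and y': "y' permutes {1..n}" and x: "x permutes {1..n}"
    using walk_permutes ts ds d(9) us v by blast+
  have "x e < x f \<and> x f = v f"
    using walk_same_first_bound[OF us xw split(2) d(6,3,4,5)] .
  moreover have "y e = x e"
    using walk_unmoved[OF vs, of e] split(3) walk_sides[OF vs] d(3) by fastforce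
  ultimately have ye: "y e < v f"
    by simp
  have y'e: "v f \<le> y' e"
    using walk_mono[OF ds d(3)] by (simp add: act_apply)
  have v_le_y: "v l \<le> y l" if "l \<le> k" for l
    using walk_mono[OF ts that] .
  have v_le_y': "v l \<le> y' l" if "l \<le> k" for l
    using walk_mono[OF _ that, of n v "(e, f) # ds" y'] s ds by simp
  \<comment> \<open>A position \<open>l\<close> lifted across the level \<open>y e\<close> is moved
    only by \<open>vs\<close>, so \<open>w l < w e\<close>. If \<open>l < e\<close>, the order
    \<open>x l < x e\<close> persists to \<open>y\<close>; if \<open>e < l\<close>, the order
    \<open>y e < y l\<close> persists to \<open>w\<close>. Both are contradictory.\<close>
  have cross: "y e < v l" if l: "1 \<le> l" "l \<le> k" "y e < y l" for l
  proof (rule ccontr)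
    assume "\<not> y e < v l"
    then have "v l \<noteq> y l" "l \<noteq> e"
      using l by auto
    have "l \<notin> fst ` set us"
      using split(2) \<open>l \<noteq> e\<close> by auto
    then have xl: "x l = v l"
      using walk_unmoved[OF us, of l] walk_sides[OF us] l(2) by fastforce
    then have "l \<in> fst ` set vs"
      using walk_unmoved[OF vs, of l] walk_sides[OF vs] l(2) \<open>v l \<noteq> y l\<close> by fastforce
    then have wl: "w l < w e"
      using split(3) by auto
    have "x l \<noteq> x e"
      using permutes_eq_iff[OF x] \<open>l \<noteq> e\<close> by blast
    then have xle: "x l < x e"
      using xl \<open>y e = x e\<close> \<open>\<not> y e < v l\<close> by simp
    show False
    proof (cases "l < e")
      case True
      then have "same_side n k l e"
        using l d by (auto simp: same_side_def)
      from walk_same_side[OF vs this xle] l(3) show False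
        by simp
    next
      case False
      then have "same_side n k e l"
        using l d \<open>l \<noteq> e\<close> by (auto simp: same_side_def)
      from walk_same_side[OF rs this l(3)] wl show False
        by simp
    qed
  qed
  have count: "card {l \<in> {1..k}. y e < z l} = card {q \<in> sigma k z. y e < q}"
    if "z permutes {1..n}" for z
  proof -
    have "{q \<in> sigma k z. y e < q} = z ` {l \<in> {1..k}. y e < z l}"
      by (auto simp: sigma_def)
    then show ?thesis
      using card_image[OF permutes_inj_on[OF that]] by simp
  qed
  \<comment> \<open>The competing walk keeps every position that was above the level in
    \<open>v\<close> and adds \<open>e\<close>. The numbers of elements above the level then differ,
    although by \<open>count\<close> they depend only on the common k-subset.\<close>
  have "{l \<in> {1..k}. y e < y l} \<subset> {l \<in> {1..k}. y e < y' l}"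
  proof
    show "{l \<in> {1..k}. y e < y l} \<subseteq> {l \<in> {1..k}. y e < y' l}"
      using cross v_le_y' by (auto intro: less_le_trans)
    have "e \<in> {l \<in> {1..k}. y e < y' l}" "e \<notin> {l \<in> {1..k}. y e < y l}"
      using ye y'e d by auto
    then show "{l \<in> {1..k}. y e < y l} \<noteq> {l \<in> {1..k}. y e < y' l}"
      by blast
  qed
  then have "card {l \<in> {1..k}. y e < y l} < card {l \<in> {1..k}. y e < y' l}"
    by (intro psubset_card_mono) auto
  then show False
    using count[OF y] count[OF y'] eq by simp
qed

end

section \<open>The rank order and the lifting property\<close>

definition cnt :: "(nat \<Rightarrow> nat) \<Rightarrow> nat \<Rightarrow> nat set \<Rightarrow> nat" where
  "cnt v q A = card {l \<in> A. q \<le> v l}"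

text \<open>This is the rank-matrix criterion for the Bruhat order; in contrast to generation by
  steps, it can be checked at one pair \<open>(p, q)\<close> at a time.\<close>

definition rank_le :: "nat \<Rightarrow> (nat \<Rightarrow> nat) \<Rightarrow> (nat \<Rightarrow> nat) \<Rightarrow> bool" where
  "rank_le n v w \<longleftrightarrow> (\<forall>p\<le>n. \<forall>q. cnt v q {1..p} \<le> cnt w q {1..p})"

lemma cnt_empty [simp]: "cnt v q {} = 0"
  by (simp add: cnt_def)

lemma cnt_Un:
  assumes "finite A" "finite B" "A \<inter> B = {}"
  shows "cnt v q (A \<union> B) = cnt v q A + cnt v q B"
proof -
  have "{l \<in> A \<union> B. q \<le> v l} = {l \<in> A. q \<le> v l} \<union> {l \<in> B. q \<le> v l}"
    by auto
  then show ?thesis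
    unfolding cnt_def using assms by (simp add: card_Un_disjoint disjoint_iff)
qed

lemma cnt_insert:
  assumes "finite A" "a \<notin> A"
  shows "cnt v q (insert a A) = of_bool (q \<le> v a) + cnt v q A"
  using cnt_Un[of "{a}" A v q] assms
  by (cases "q \<le> v a") (auto simp: cnt_def Collect_conv_if conj_commute)

lemma cnt_mono:
  assumes "finite A" "\<And>l. l \<in> A \<Longrightarrow> q \<le> v l \<Longrightarrow> q \<le> w l"
  shows "cnt v q A \<le> cnt w q A"
  unfolding cnt_def by (rule card_mono) (use assms in auto)

lemma cnt_cong: "(\<And>l. l \<in> A \<Longrightarrow> v l = w l) \<Longrightarrow> cnt v q A = cnt w q A"
  unfolding cnt_def by (rule arg_cong[where f = card]) auto

lemma cnt_split_left:
  assumes "1 \<le> i" "i \<le> p"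
  shows "cnt v q {1..p} = cnt v q {1..i - 1} + of_bool (q \<le> v i) + cnt v q {i<..p}"
proof -
  have eq: "{1..p} = {1..i - 1} \<union> insert i {i<..p}"
    using assms by auto
  have "cnt v q {1..p} = cnt v q {1..i - 1} + cnt v q (insert i {i<..p})"
    unfolding eq by (rule cnt_Un) (use assms in auto)
  then show ?thesis
    by (simp add: cnt_insert)
qed

lemma cnt_split_right:
  assumes "p < j"
  shows "cnt v q {1..j} = cnt v q {1..p} + cnt v q {p<..<j} + of_bool (q \<le> v j)"
proof -
  have eq: "{1..j} = {1..p} \<union> insert j {p<..<j}"
    using assms by auto
  have "cnt v q {1..j} = cnt v q {1..p} + cnt v q (insert j {p<..<j})"
    unfolding eq by (rule cnt_Un) (use assms in auto)
  then show ?thesis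
    by (simp add: cnt_insert)
qed

text \<open>A prefix that ends before \<open>i\<close> is untouched and one that reaches
  \<open>j\<close> is only permuted. In between, \<open>v j\<close> replaces \<open>v i\<close>,
  which counts for thresholds \<open>q\<close> between the two values.\<close>

lemma cnt_transpose:
  assumes ij: "1 \<le> i" "i < j" and v: "v i < v j"
  shows "cnt (v \<circ> transpose i j) q {1..p} =
    cnt v q {1..p} + of_bool (i \<le> p \<and> p < j \<and> v i < q \<and> q \<le> v j)"
proof -
  let ?v = "v \<circ> transpose i j"
  consider "p < i" | "i \<le> p" "p < j" | "j \<le> p"
    by linarith
  then show ?thesis
  proof cases
    case 1
    then show ?thesis
      using cnt_cong[of "{1..p}" ?v v q] ij by simp
  next
    case 2
    then have "cnt ?v q {1..i - 1} = cnt v q {1..i - 1}" "cnt ?v q {i<..p} = cnt v q {i<..p}"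
      using ij by (auto intro!: cnt_cong)
    then show ?thesis
      using cnt_split_left[OF ij(1) 2(1)] 2 v by simp
  next
    case 3
    have "{l \<in> {1..p}. q \<le> ?v l} = transpose i j ` {l \<in> {1..p}. q \<le> v l}"
    proof (intro set_eqI iffI)
      fix l
      assume "l \<in> {l \<in> {1..p}. q \<le> ?v l}"
      then show "l \<in> transpose i j ` {l \<in> {1..p}. q \<le> v l}"
        using 3 ij by (intro image_eqI[of _ _ "transpose i j l"]) (auto simp: transpose_def)
    qed (use 3 ij in \<open>auto simp: transpose_def\<close>)
    then show ?thesis
      using 3 card_image[OF inj_on_transpose, of i j] by (simp add: cnt_def)
  qed
qed

lemma rank_le_refl: "rank_le n v v"
  by (simp add: rank_le_def)

lemma rank_le_trans: "rank_le n v w \<Longrightarrow> rank_le n w x \<Longrightarrow> rank_le n v x"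
  unfolding rank_le_def using le_trans by blast

lemma rank_le_transpose:
  assumes "1 \<le> i" "i < j" "v i < v j"
  shows "rank_le n v (v \<circ> transpose i j)"
  using cnt_transpose[OF assms] by (simp add: rank_le_def)

text \<open>Let \<open>i\<close> be the first difference; the rank condition gives
  \<open>v i < w i\<close>. Without a new inversion, every later position below \<open>w i\<close>
  in \<open>w\<close> is below \<open>v i\<close> in \<open>v\<close>. But the values up to
  \<open>v i\<close> that \<open>v\<close> takes from \<open>i\<close> on all occur later than
  \<open>i\<close> in \<open>w\<close>, which is one too many.\<close>

lemma ex_new_inversion:
  assumes v: "v permutes {1..n}" and w: "w permutes {1..n}" and le: "rank_le n v w"
    and ne: "v \<noteq> w"
  shows "\<exists>i j. 1 \<le> i \<and> i < j \<and> j \<le> n \<and> v i < v j \<and> w j < w i"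
proof (rule ccontr)
  assume no: "\<not> ?thesis"
  define i where "i = (LEAST i. v i \<noteq> w i)"
  have before: "v l = w l" if "l < i" for l
    using that not_less_Least unfolding i_def by blast
  have i: "v i \<noteq> w i"
    using ne unfolding i_def fun_eq_iff not_all by (rule LeastI_ex)
  then have iin: "1 \<le> i" "i \<le> n"
    using permutes_not_in[OF v, of i] permutes_not_in[OF w, of i] by (metis atLeastAtMost_iff)+
  have "cnt v (v i) {1..i - 1} = cnt w (v i) {1..i - 1}"
    using before iin by (intro cnt_cong) auto
  moreover have "cnt v (v i) {1..i} \<le> cnt w (v i) {1..i}"
    using le iin by (simp add: rank_le_def)
  ultimately have "v i \<le> w i"
    using cnt_split_left[OF iin(1) order.refl, of v "v i"]
      cnt_split_left[OF iin(1) order.refl, of w "v i"] by (cases "v i \<le> w i") auto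
  then have less: "v i < w i"
    using i by simp
  define A where "A = {l \<in> {i<..n}. w l < w i}"
  define B where "B = {l \<in> {i<..n}. v l < v i}"
  have "A \<subseteq> B"
  proof
    fix l
    assume "l \<in> A"
    then have "\<not> v i < v l" "l \<noteq> i" "l \<in> {i<..n}"
      using no iin by (auto simp: A_def)
    then show "l \<in> B"
      using permutes_eq_iff[OF v, of l i] by (auto simp: B_def)
  qed
  then have AB: "card A \<le> card B"
    by (intro card_mono) (auto simp: B_def)
  \<comment> \<open>\<open>g l\<close> is the position at which \<open>w\<close> takes the value
    \<open>v l\<close>.\<close>
  define g where "g = inv w \<circ> v"
  have wg: "w (g l) = v l" for l
    using permutes_inverses(1)[OF w] by (simp add: g_def)
  have gin: "g permutes {1..n}"
    unfolding g_def by (rule permutes_compose[OF v permutes_inv[OF w]])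
  have "g ` insert i B \<subseteq> A"
  proof
    fix m
    assume "m \<in> g ` insert i B"
    then obtain l where l: "l \<in> insert i B" "m = g l"
      by blast
    then have vl: "v l \<le> v i" "i \<le> l" "l \<in> {1..n}"
      using iin by (auto simp: B_def)
    have "i < g l"
    proof (rule ccontr)
      assume "\<not> i < g l"
      moreover have "g l \<noteq> i"
        using wg[of l] vl less by auto
      ultimately have "g l < i"
        by simp
      then have "v (g l) = v l"
        using before wg by simp
      then have "g l = l"
        using permutes_eq_iff[OF v] by blast
      then show False
        using \<open>g l < i\<close> vl by simp
    qed
    moreover have "g l \<in> {1..n}"
      using permutes_in_image[OF gin] vl(3) by simp
    ultimately show "m \<in> A"
      using wg[of l] vl less l by (simp add: A_def)
  qed
  then have "card (g ` insert i B) \<le> card A"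
    by (intro card_mono) (auto simp: A_def)
  moreover have "card (g ` insert i B) = card (insert i B)"
    by (rule card_image[OF permutes_inj_on[OF gin]])
  moreover have "card (insert i B) = Suc (card B)"
    by (rule card_insert_disjoint) (auto simp: B_def)
  ultimately show False
    using AB by simp
qed

text \<open>
  The generalized lifting property of Tsukerman and Williams: the closest pair of positions
  inverted in \<open>w\<close> but not in \<open>v\<close> works.
\<close>

lemma rank_le_lifting:
  assumes v: "v permutes {1..n}" and w: "w permutes {1..n}" and le: "rank_le n v w"
    and ne: "v \<noteq> w"
  shows "\<exists>i j. 1 \<le> i \<and> i < j \<and> j \<le> n \<and> v i < v j \<and> w j < w i \<and>
    perm_length n (v \<circ> transpose i j) = Suc (perm_length n v) \<and>
    rank_le n (v \<circ> transpose i j) w"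
proof -
  define P where "P = (\<lambda>(i, j). 1 \<le> i \<and> i < j \<and> j \<le> n \<and> v i < v j \<and> w j < w i)"
  have "\<exists>x. P x"
    using ex_new_inversion[OF assms] by (auto simp: P_def)
  then obtain x where x: "P x" "\<And>y. P y \<Longrightarrow> snd x - fst x \<le> snd y - fst y"
    using ex_has_least_nat[of P _ "\<lambda>x. snd x - fst x"] by blast
  obtain i j where "x = (i, j)"
    by (cases x)
  with x have ij: "1 \<le> i" "i < j" "j \<le> n" "v i < v j" "w j < w i"
    and min: "\<And>i' j'. P (i', j') \<Longrightarrow> j - i \<le> j' - i'"
    by (auto simp: P_def)
  \<comment> \<open>By minimality neither \<open>(i, l)\<close> nor \<open>(l, j)\<close> qualifies,
    which leaves only these two configurations of values at \<open>l\<close>.\<close>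
  have between: "v l < v i \<and> w l < w j \<or> v j < v l \<and> w i < w l" if l: "i < l" "l < j" for l
  proof -
    have "\<not> P (i, l)" "\<not> P (l, j)"
      using min[of i l] min[of l j] l by auto
    moreover have "v l \<noteq> v i" "v l \<noteq> v j" "w l \<noteq> w i" "w l \<noteq> w j"
      using permutes_eq_iff[OF v] permutes_eq_iff[OF w] l by auto
    ultimately show ?thesis
      using ij l unfolding P_def prod.case by linarith
  qed
  have "perm_length n (v \<circ> transpose i j) = Suc (perm_length n v)"
    unfolding perm_length_cover_iff[OF v ij(1-3)] using ij between by fastforce
  moreover have "rank_le n (v \<circ> transpose i j) w"
    unfolding rank_le_def
  proof (intro allI impI)
    fix p q
    assume p: "p \<le> n"
    have le': "cnt v q {1..r} \<le> cnt w q {1..r}" if "r \<le> n" for r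
      using le that by (simp add: rank_le_def)
    show "cnt (v \<circ> transpose i j) q {1..p} \<le> cnt w q {1..p}"
    proof (cases "i \<le> p \<and> p < j \<and> v i < q \<and> q \<le> v j")
      case True
      then have r: "i \<le> p" "p < j" "v i < q" "q \<le> v j"
        by auto
      \<comment> \<open>Inside the rectangle where the count grows, one unit of slack is needed. If
        \<open>q \<le> w i\<close>, it comes from position \<open>i\<close>, starting at the prefix
        before \<open>i\<close>; otherwise it comes from position \<open>j\<close>, working back
        from the prefix ending at \<open>j\<close>. The positions in between compare by
        \<open>between\<close>.\<close>
      have "Suc (cnt v q {1..p}) \<le> cnt w q {1..p}"
      proof (cases "q \<le> w i")
        case True
        have i1: "i - 1 \<le> n"
          using ij by simp
        have "q \<le> w l" if "l \<in> {i<..p}" "q \<le> v l" for l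
          using between[of l] that r True by auto
        then have "cnt v q {i<..p} \<le> cnt w q {i<..p}"
          by (intro cnt_mono) auto
        then show ?thesis
          using cnt_split_left[OF ij(1) r(1), of v q] cnt_split_left[OF ij(1) r(1), of w q]
            le'[OF i1] True r by (simp add: of_bool_def)
      next
        case False
        have "q \<le> v l" if "l \<in> {p<..<j}" "q \<le> w l" for l
          using between[of l] that r False ij by auto
        then have "cnt w q {p<..<j} \<le> cnt v q {p<..<j}"
          by (intro cnt_mono) auto
        then show ?thesis
          using cnt_split_right[OF r(2), of v q] cnt_split_right[OF r(2), of w q]
            le'[of j] ij False r by simp
      qed
      then show ?thesis
        using cnt_transpose[OF ij(1,2,4), of q p] True by simp
    next
      case False
      then show ?thesis
        using cnt_transpose[OF ij(1,2,4), of q p] le'[OF p] by (simp only: False of_bool_eq add_0_right)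
    qed
  qed
  ultimately show ?thesis
    using ij by blast
qed

lemma perm_length_le: "perm_length n v \<le> n * n"
proof -
  have "perm_length n v \<le> card ({1..n} \<times> {1..n})"
    unfolding perm_length_def by (rule card_mono) auto
  then show ?thesis
    by simp
qed

lemma bruhat_step_rank_le:
  assumes "bruhat_step n x y"
  shows "rank_le n x y"
  using assms perm_length_less_iff rank_le_transpose by (auto simp: bruhat_step_def)

lemma bruhat_le_rank_le: "bruhat_le n x y \<Longrightarrow> rank_le n x y"
  unfolding bruhat_le_def
  by (induction rule: rtranclp_induct) (auto intro: rank_le_refl rank_le_trans bruhat_step_rank_le)

lemma bruhat_le_length: "bruhat_le n x y \<Longrightarrow> x = y \<or> perm_length n x < perm_length n y"
  unfolding bruhat_le_def
proof (induction rule: rtranclp_induct)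
  case (step y z)
  then have "perm_length n y < perm_length n z"
    by (simp add: bruhat_step_def)
  with step.IH show ?case
    by auto
qed simp

lemma card_sigma_ge:
  assumes "x permutes {1..n}"
  shows "card {s \<in> sigma k x. q \<le> s} = cnt x q {1..k}"
proof -
  have "{s \<in> sigma k x. q \<le> s} = x ` {l \<in> {1..k}. q \<le> x l}"
    by (auto simp: sigma_def)
  then show ?thesis
    using card_image[OF permutes_inj_on[OF assms]] by (simp add: cnt_def)
qed

lemma sigma_mem_iff:
  assumes "x permutes {1..n}"
  shows "q \<in> sigma k x \<longleftrightarrow> cnt x q {1..k} \<noteq> cnt x (Suc q) {1..k}"
proof -
  have fin: "finite (sigma k x)"
    by (simp add: sigma_def)
  have "{s \<in> sigma k x. q \<le> s} = (if q \<in> sigma k x then insert q {s \<in> sigma k x. Suc q \<le> s}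
      else {s \<in> sigma k x. Suc q \<le> s})"
    by (auto simp: Suc_le_eq le_less)
  then show ?thesis
    unfolding card_sigma_ge[OF assms, symmetric] using fin by auto
qed

text \<open>The counts on \<open>{1..k}\<close> are monotone in the rank order, depend only on the
  k-subset and determine it, so equality at both ends fixes it in the middle.\<close>

lemma sigma_squeeze:
  assumes "x permutes {1..n}" "y permutes {1..n}" "z permutes {1..n}" "k \<le> n"
    and "rank_le n x y" "rank_le n y z" "sigma k x = sigma k z"
  shows "sigma k y = sigma k z"
proof -
  have "cnt y q {1..k} = cnt z q {1..k}" for q
  proof (rule antisym)
    have "cnt z q {1..k} = cnt x q {1..k}"
      using card_sigma_ge assms(1,3,7) by metis
    then show "cnt z q {1..k} \<le> cnt y q {1..k}"
      using assms(4,5) by (simp add: rank_le_def)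
  qed (use assms(4,6) in \<open>simp add: rank_le_def\<close>)
  then show ?thesis
    using sigma_mem_iff[OF assms(2)] sigma_mem_iff[OF assms(3)] by auto
qed

section \<open>Lifting Bruhat chains to walks\<close>

lemma same_side_or_cross:
  assumes "1 \<le> a" "a < b" "b \<le> n"
  shows "same_side n k a b \<or> a \<le> k \<and> k < b"
  using assms by (auto simp: same_side_def)

text \<open>Lifting yields a cover of \<open>y\<close> still below \<open>z\<close>. A crossing
  cover becomes the first step; a same-side one is removed from the inductive walk by
  \<open>walk_conj_up\<close>, at the price of possibly lowering its end by a same-side factor.
  Hence only \<open>sigma k\<close> of the end is controlled.\<close>

lemma walk_lift:
  assumes "y permutes {1..n}" "z permutes {1..n}" "rank_le n y z" "k \<le> n"
  shows "\<exists>ts z'. walk n k y ts z' \<and> rank_le n z' z \<and> sigma k z' = sigma k z"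
  using assms
proof (induction "n * n - perm_length n y" arbitrary: y rule: less_induct)
  case less
  show ?case
  proof (cases "y = z")
    case True
    then have "walk n k y [] z"
      by simp
    then show ?thesis
      using rank_le_refl by blast
  next
    case False
    obtain a b where ab: "1 \<le> a" "a < b" "b \<le> n" "y a < y b"
      and l: "perm_length n (y \<circ> transpose a b) = Suc (perm_length n y)"
      and le: "rank_le n (y \<circ> transpose a b) z"
      using rank_le_lifting[OF less.prems(1-3) False] by blast
    let ?y = "y \<circ> transpose a b"
    have p: "?y permutes {1..n}"
      using less.prems(1) ab by (intro transpose_permutes) auto
    have "n * n - perm_length n ?y < n * n - perm_length n y"
      using l perm_length_le[of n ?y] by linarith
    from less.hyps[OF this p less.prems(2) le less.prems(4)] obtain ts z' where
      z': "walk n k ?y ts z'" "rank_le n z' z" "sigma k z' = sigma k z"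
      by blast
    consider "a \<le> k" "k < b" | "same_side n k a b"
      using same_side_or_cross[OF ab(1-3)] by blast
    then show ?thesis
    proof cases
      case 1
      then have "kstep n k y (a, b)"
        using less.prems(1) ab l by (intro kstepI) (auto simp: act_def)
      then have "walk n k y ((a, b) # ts) z'"
        using z'(1) by (simp add: act_def)
      with z' show ?thesis
        by blast
    next
      case 2
      from walk_conj_up[OF z'(1) less.prems(1) 2 l] show ?thesis
      proof (elim disjE conjE exE)
        fix ts'
        assume *: "z' b < z' a" "walk n k y ts' (z' \<circ> transpose a b)"
        have "rank_le n (z' \<circ> transpose a b) (z' \<circ> transpose a b \<circ> transpose a b)"
          using * ab by (intro rank_le_transpose) auto
        then have "rank_le n (z' \<circ> transpose a b) z'"
          by (simp add: comp_assoc)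
        then show ?thesis
          using * z' sigma_same_side[OF 2, of z'] rank_le_trans by metis
      qed (use z' in blast)
    qed
  qed
qed

text \<open>Each lifting step from \<open>w'\<close> towards \<open>w\<close> is same-side, because
  \<open>sigma k\<close> is squeezed between equal ends. Its pair is inverted in \<open>w\<close>,
  hence already in \<open>u\<close>, since the walk \<open>ss\<close> creates no same-side
  inversion; so \<open>walk_absorb_down\<close> applies. Here the k-Bruhat relation between
  \<open>u\<close> and \<open>w\<close> enters.\<close>

lemma walk_raise_top:
  assumes "walk n k u ss w" "u permutes {1..n}" "k \<le> n"
    and "walk n k u ts w'" "rank_le n w' w" "sigma k w' = sigma k w"
  shows "\<exists>ts'. walk n k u ts' w \<and> img k u ts \<subseteq> img k u ts'"
  using assms(4-6)
proof (induction "n * n - perm_length n w'" arbitrary: w' ts rule: less_induct)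
  case less
  show ?case
  proof (cases "w' = w")
    case True
    then show ?thesis
      using less.prems(1) by blast
  next
    case False
    have w': "w' permutes {1..n}" and w: "w permutes {1..n}"
      using walk_permutes assms(1,2) less.prems(1) by blast+
    obtain a b where ab: "1 \<le> a" "a < b" "b \<le> n" "w' a < w' b" "w b < w a"
      and l: "perm_length n (w' \<circ> transpose a b) = Suc (perm_length n w')"
      and le: "rank_le n (w' \<circ> transpose a b) w"
      using rank_le_lifting[OF w' w less.prems(2) False] by blast
    let ?w = "w' \<circ> transpose a b"
    have p: "?w permutes {1..n}"
      using w' ab by (intro transpose_permutes) auto
    have sigma: "sigma k ?w = sigma k w"
      using rank_le_transpose[of a b w' n] ab(1,2,4) le less.prems(3)
      by (intro sigma_squeeze[OF w' p w assms(3)])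
    have ss: "same_side n k a b"
    proof (rule ccontr)
      assume "\<not> same_side n k a b"
      then have "a \<le> k" "k < b"
        using same_side_or_cross[OF ab(1-3)] by auto
      then have "kstep n k w' (a, b)"
        using w' ab l by (intro kstepI) (auto simp: act_def)
      from kstep_sum_sigma[OF this] sigma less.prems(3) show False
        by (simp add: act_def)
    qed
    have uab: "u b < u a"
      by (rule walk_same_side_iff[OF assms(1,2) ss ab(5)])
    obtain ts1 where ts1: "walk n k u ts1 ?w" "img k u ts \<subseteq> img k u ts1"
      using walk_absorb_down[OF less.prems(1) assms(2) ss uab l] by blast
    have "n * n - perm_length n ?w < n * n - perm_length n w'"
      using l perm_length_le[of n ?w] by linarith
    from less.hyps[OF this ts1(1) le sigma] ts1(2) show ?thesis
      by blast
  qed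
qed

text \<open>Induction removes the longest element \<open>m\<close>, which is the top of the chain.
  The walk for the rest ends at some \<open>m'\<close> below \<open>m\<close> with the same
  k-subset, and \<open>walk_lift\<close> continues it from \<open>m'\<close>.\<close>

lemma chain_lift:
  assumes "u permutes {1..n}" "k \<le> n"
    and "finite C" "\<And>x. x \<in> C \<Longrightarrow> x permutes {1..n} \<and> rank_le n u x \<and> rank_le n x z"
    and "\<And>x y. x \<in> C \<Longrightarrow> y \<in> C \<Longrightarrow> bruhat_le n x y \<or> bruhat_le n y x"
    and "z permutes {1..n}" "rank_le n u z"
  shows "\<exists>ts z'. walk n k u ts z' \<and> rank_le n z' z \<and> sigma k z' = sigma k z \<and>
    sigma k ` C \<subseteq> img k u ts"
  using assms(3-7)
proof (induction "card C" arbitrary: C z)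
  case 0
  then show ?case
    using walk_lift[OF assms(1) 0(5,6) assms(2)] by auto
next
  case (Suc N)
  then have ne: "C \<noteq> {}"
    by auto
  have "Max (perm_length n ` C) \<in> perm_length n ` C"
    using Suc.prems(1) ne by (intro Max_in) auto
  then obtain m where m: "m \<in> C" "Max (perm_length n ` C) = perm_length n m"
    by blast
  have max: "perm_length n x \<le> perm_length n m" if "x \<in> C" for x
    using Suc.prems(1) that unfolding m(2)[symmetric] by (intro Max_ge) auto
  have le_m: "bruhat_le n x m" if "x \<in> C" for x
    using Suc.prems(3)[OF that m(1)] bruhat_le_length[of n m x] max[OF that] by auto
  have "\<exists>ts m'. walk n k u ts m' \<and> rank_le n m' m \<and> sigma k m' = sigma k m \<and>
      sigma k ` (C - {m}) \<subseteq> img k u ts"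
    using Suc.hyps(2) Suc.prems(1-3) m(1) le_m bruhat_le_rank_le
    by (intro Suc.hyps(1)) auto
  then obtain ts m' where m': "walk n k u ts m'" "rank_le n m' m" "sigma k m' = sigma k m"
    "sigma k ` (C - {m}) \<subseteq> img k u ts"
    by blast
  have "rank_le n m' z"
    using m'(2) Suc.prems(2)[OF m(1)] rank_le_trans by blast
  from walk_lift[OF walk_permutes[OF m'(1) assms(1)] Suc.prems(4) this assms(2)]
  obtain ss z' where z': "walk n k m' ss z'" "rank_le n z' z" "sigma k z' = sigma k z"
    by blast
  have "walk n k u (ts @ ss) z'"
    using m'(1) z'(1) by (auto simp: walk_append)
  moreover have "sigma k ` C \<subseteq> img k u (ts @ ss)"
    using img_append[OF m'(1), of ss] m'(3,4) end_in_img[OF m'(1)] by auto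
  ultimately show ?case
    using z' by blast
qed

text \<open>\<open>chain_lift\<close> reaches the k-subset of \<open>w\<close> at some
  \<open>w'\<close> below \<open>w\<close>, and \<open>walk_raise_top\<close> then repairs the end.
  This controls all faces of the complex by k-Bruhat walks.\<close>

lemma chain_in_walk:
  assumes "walk n k u ss w" "u permutes {1..n}" "k \<le> n"
    and "C \<in> order_complex (bruhat_le n) (bruhat_interval n u w)"
  shows "\<exists>ts. walk n k u ts w \<and> sigma k ` C \<subseteq> img k u ts"
proof -
  have w: "w permutes {1..n}"
    by (rule walk_permutes[OF assms(1,2)])
  show ?thesis
  proof (cases "C = {}")
    case True
    then show ?thesis
      using assms(1) by auto
  next
    case False
    have C: "finite C" "\<And>x. x \<in> C \<Longrightarrow> x permutes {1..n} \<and> rank_le n u x \<and> rank_le n x w"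
      "\<And>x y. x \<in> C \<Longrightarrow> y \<in> C \<Longrightarrow> bruhat_le n x y \<or> bruhat_le n y x"
      using assms(4) bruhat_le_rank_le by (auto simp: order_complex_def bruhat_interval_def)
    have "rank_le n u w"
      using False C(2) rank_le_trans by blast
    from chain_lift[OF assms(2,3) C w this] obtain ts w' where
      "walk n k u ts w'" "rank_le n w' w" "sigma k w' = sigma k w" "sigma k ` C \<subseteq> img k u ts"
      by blast
    with walk_raise_top[OF assms(1-3) this(1-3)] show ?thesis
      by blast
  qed
qed

section \<open>Facets\<close>

lemma sorted_wrt_unique:
  assumes "sorted_wrt R xs" "sorted_wrt R ys" "set xs = set ys"
    and "\<And>x y. x \<in> set xs \<Longrightarrow> y \<in> set xs \<Longrightarrow> R x y \<Longrightarrow> \<not> R y x"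
  shows "xs = ys"
  using assms
proof (induction xs arbitrary: ys)
  case (Cons x xs)
  have "ys \<noteq> []"
    using Cons.prems(3) by auto
  then obtain y ys' where ys: "ys = y # ys'"
    by (cases ys) auto
  have irrefl: "\<not> R z z" if "z \<in> set (x # xs)" for z
    using Cons.prems(4) that by blast
  have "x = y"
  proof (rule ccontr)
    assume "x \<noteq> y"
    then have "x \<in> set ys'" "y \<in> set xs"
      using Cons.prems(3) ys by auto
    then show False
      using Cons.prems(1,2) Cons.prems(4)[of x y] ys by auto
  qed
  moreover have "x \<notin> set xs" "y \<notin> set ys'"
    using Cons.prems(1,2,3) irrefl ys by auto
  ultimately have "set xs = set ys'"
    using Cons.prems(3) ys by auto
  then have "xs = ys'"
    using Cons.prems ys by (intro Cons.IH) auto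
  with \<open>x = y\<close> ys show ?case
    by simp
qed simp

lemma sorted_wrt_exists:
  assumes "finite A"
    and "\<And>x y z. x \<in> A \<Longrightarrow> y \<in> A \<Longrightarrow> z \<in> A \<Longrightarrow> R x y \<Longrightarrow> R y z \<Longrightarrow> R x z"
    and "\<And>x y. x \<in> A \<Longrightarrow> y \<in> A \<Longrightarrow> x \<noteq> y \<Longrightarrow> R x y \<or> R y x"
    and "\<And>x. x \<in> A \<Longrightarrow> \<not> R x x"
  shows "\<exists>xs. set xs = A \<and> distinct xs \<and> sorted_wrt R xs"
  using assms
proof (induction A)
  case (insert a A)
  have "\<exists>xs. set xs = A \<and> distinct xs \<and> sorted_wrt R xs"
    by (rule insert.IH) (use insert.prems in blast)+
  then obtain xs where xs: "set xs = A" "distinct xs" "sorted_wrt R xs"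
    by blast
  let ?xs = "filter (\<lambda>x. R x a) xs @ a # filter (R a) xs"
  have asym: "\<not> (R x a \<and> R a x)" if "x \<in> A" for x
    using insert.prems(1)[of x a x] insert.prems(3)[of x] that by blast
  have "set ?xs = insert a A"
    using xs(1) insert.prems(2)[of _ a] insert.hyps(2) by auto
  moreover have "distinct ?xs"
    using xs insert.hyps(2) asym by (auto simp: distinct_filter)
  moreover have "sorted_wrt R ?xs"
    using xs insert.prems(1)
    by (auto simp: sorted_wrt_append sorted_wrt_filter)
  ultimately show ?case
    by blast
qed simp

section \<open>Walks as maximal chains, and their labels\<close>

fun verts :: "(nat \<Rightarrow> nat) \<Rightarrow> (nat \<times> nat) list \<Rightarrow> (nat \<Rightarrow> nat) list" where
  "verts x [] = [x]"
| "verts x (t # ts) = x # verts (act x t) ts"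

lemma hd_verts: "verts x ts = x # tl (verts x ts)"
  by (cases ts) auto

lemma img_verts: "img k x ts = sigma k ` set (verts x ts)"
  by (induction ts arbitrary: x) auto

lemma bruhat_step_transposeI:
  assumes "x permutes {1..n}" "1 \<le> i" "i < j" "j \<le> n" "x i < x j"
  shows "bruhat_step n x (x \<circ> transpose i j)"
  using assms perm_length_less_iff[OF assms(1-4)] by (auto simp: bruhat_step_def)

lemma bruhat_step_less: "bruhat_step n x y \<Longrightarrow> bruhat_less n x y"
  using r_into_rtranclp[of "bruhat_step n" x y]
  by (auto simp: bruhat_less_def bruhat_le_def) (simp add: bruhat_step_def)

lemma bruhat_cover_transpose:
  assumes "bruhat_cover n x y"
  shows "x permutes {1..n} \<and> (\<exists>i j. 1 \<le> i \<and> i < j \<and> j \<le> n \<and> y = x \<circ> transpose i j \<and>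
    perm_length n y = Suc (perm_length n x))"
proof -
  have "(bruhat_step n)\<^sup>*\<^sup>* x y" "x \<noteq> y"
    using assms by (auto simp: bruhat_cover_def bruhat_less_def bruhat_le_def)
  then obtain z where z: "bruhat_step n x z" "(bruhat_step n)\<^sup>*\<^sup>* z y"
    by (metis converse_rtranclpE)
  then have "y = z"
    using assms bruhat_step_less[OF z(1)]
    by (auto simp: bruhat_cover_def bruhat_less_def bruhat_le_def)
  with z(1) obtain i j where x: "x permutes {1..n}" and ij: "1 \<le> i" "i < j" "j \<le> n"
    and y: "y = x \<circ> transpose i j" and lt: "perm_length n x < perm_length n y"
    by (auto simp: bruhat_step_def)
  have xij: "x i < x j"
    using lt perm_length_less_iff[OF x ij] y by simp
  have "perm_length n y = Suc (perm_length n x)"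
  proof (rule ccontr)
    assume "perm_length n y \<noteq> Suc (perm_length n x)"
    then obtain l where l: "i < l" "l < j" "x i < x l" "x l < x j"
      using perm_length_cover_iff[OF x ij] xij y by auto
    \<comment> \<open>An intermediate value at \<open>l\<close> factors the exchange of
      \<open>i\<close> and \<open>j\<close> into three ascending steps, by \<open>(i l)\<close>,
      \<open>(i j)\<close> and \<open>(l j)\<close>. The first intermediate permutation already
      contradicts the cover.\<close>
    let ?a = "x \<circ> transpose i l"
    let ?b = "?a \<circ> transpose i j"
    have a: "?a permutes {1..n}"
      by (rule transpose_permutes[OF x]) (use ij l in auto)
    have b: "?b permutes {1..n}"
      by (rule transpose_permutes[OF a]) (use ij in auto)
    have 1: "bruhat_step n x ?a"
      by (rule bruhat_step_transposeI[OF x]) (use ij l in auto)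
    have 2: "bruhat_step n ?a ?b"
      by (rule bruhat_step_transposeI[OF a]) (use ij l in auto)
    have "bruhat_step n ?b (?b \<circ> transpose l j)"
      by (rule bruhat_step_transposeI[OF b]) (use ij l in auto)
    moreover have "?b \<circ> transpose l j = y"
      using ij l by (auto simp: y fun_eq_iff transpose_def)
    ultimately have 3: "bruhat_step n ?b y"
      by simp
    have "perm_length n ?a < perm_length n y"
      using 2 3 unfolding bruhat_step_def by linarith
    moreover have "bruhat_le n ?a y"
      unfolding bruhat_le_def using 2 3 by (meson r_into_rtranclp rtranclp.rtrancl_into_rtrancl)
    ultimately have "bruhat_less n ?a y"
      by (auto simp: bruhat_less_def)
    with bruhat_step_less[OF 1] show False
      using assms unfolding bruhat_cover_def by blast
  qed
  with x ij y show ?thesis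
    by blast
qed

context
  fixes n k :: nat
begin

lemma kstep_bruhat_step: "kstep n k x t \<Longrightarrow> bruhat_step n x (act x t)"
  using bruhat_step_transposeI[of x n "fst t" "snd t"] kstepD[of n k x "fst t" "snd t"]
  by (simp add: act_def)

text \<open>A Bruhat cover is a transposition raising the length by one, and a same-side one would
  fix \<open>sigma k\<close>. Conversely, a rise by one leaves no room for an intermediate element,
  and the sums show that the k-subset changes.\<close>

lemma k_bruhat_cover_iff: "k_bruhat_cover n k x y \<longleftrightarrow> (\<exists>t. kstep n k x t \<and> y = act x t)"
proof
  assume c: "k_bruhat_cover n k x y"
  then obtain i j where ij: "x permutes {1..n}" "1 \<le> i" "i < j" "j \<le> n"
    "y = x \<circ> transpose i j" "perm_length n y = Suc (perm_length n x)"
    using bruhat_cover_transpose unfolding k_bruhat_cover_def by blast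
  have "\<not> same_side n k i j"
    using c sigma_same_side[of n k i j x] ij(5) by (auto simp: k_bruhat_cover_def)
  then have "kstep n k x (i, j)"
    using same_side_or_cross[OF ij(2-4)] ij by (intro kstepI) (auto simp: act_def)
  then show "\<exists>t. kstep n k x t \<and> y = act x t"
    using ij(5) by (intro exI[of _ "(i, j)"]) (simp add: act_def)
next
  assume "\<exists>t. kstep n k x t \<and> y = act x t"
  then obtain t where t: "kstep n k x t" "y = act x t"
    by blast
  have "\<not> (bruhat_less n x z \<and> bruhat_less n z y)" for z
    using bruhat_le_length[of n x z] bruhat_le_length[of n z y] t
    by (auto simp: bruhat_less_def kstep_def)
  then have "bruhat_cover n x y"
    using bruhat_step_less[OF kstep_bruhat_step[OF t(1)]] t(2) by (auto simp: bruhat_cover_def)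
  then show "k_bruhat_cover n k x y"
    using kstep_sum_sigma[OF t(1)] t(2) by (auto simp: k_bruhat_cover_def)
qed

lemma k_bruhat_le_walk: "k_bruhat_le n k u w \<Longrightarrow> \<exists>ts. walk n k u ts w"
  unfolding k_bruhat_le_def
proof (induction rule: rtranclp_induct)
  case base
  have "walk n k u [] u"
    by simp
  then show ?case
    by blast
next
  case (step y z)
  then obtain ts t where "walk n k u ts y" "kstep n k y t" "z = act y t"
    using k_bruhat_cover_iff by blast
  then have "walk n k u (ts @ [t]) z"
    by (auto simp: walk_append)
  then show ?case
    by blast
qed

lemma cover_label_act:
  assumes "kstep n k x t"
  shows "cover_label n k x (act x t) = t"
proof -
  obtain i j where t: "t = (i, j)"
    by (cases t)
  note d = kstepD[OF assms[unfolded t]]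
  show ?thesis
    unfolding cover_label_def
  proof (rule the_equality)
    show "case t of (i, j) \<Rightarrow> 1 \<le> i \<and> i \<le> k \<and> k < j \<and> j \<le> n \<and> act x t = x \<circ> transpose i j"
      using d by (simp add: t act_def)
  next
    fix s
    assume s: "case s of (i, j) \<Rightarrow> 1 \<le> i \<and> i \<le> k \<and> k < j \<and> j \<le> n \<and> act x t = x \<circ> transpose i j"
    obtain a b where ab: "s = (a, b)"
      by (cases s)
    have "\<forall>l. x (transpose i j l) = x (transpose a b l)"
      using s by (simp add: ab t act_def fun_eq_iff)
    then have "x (transpose i j i) = x (transpose a b i)"
      by blast
    then have "j = transpose a b i"
      using permutes_eq_iff[OF d(1)] by simp
    then show "s = t"
      using s d(3,4) by (auto simp: ab t transpose_def split: if_splits)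
  qed
qed

lemma chain_labels_verts: "walk n k u ts w \<Longrightarrow> chain_labels n k (verts u ts) = ts"
proof (induction ts arbitrary: u)
  case Nil
  then show ?case
    by (simp add: chain_labels_def)
next
  case (Cons t ts)
  obtain r where r: "verts (act u t) ts = act u t # r"
    using hd_verts by blast
  have "chain_labels n k (verts u (t # ts)) =
      cover_label n k u (act u t) # chain_labels n k (verts (act u t) ts)"
    unfolding chain_labels_def verts.simps r by simp
  also have "\<dots> = t # ts"
    using Cons.IH Cons.prems cover_label_act by simp
  finally show ?case .
qed

lemma k_max_chain_iff: "k_max_chain n k u w c \<longleftrightarrow> (\<exists>ts. walk n k u ts w \<and> c = verts u ts)"
proof
  show "k_max_chain n k u w c \<Longrightarrow> \<exists>ts. walk n k u ts w \<and> c = verts u ts"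
  proof (induction c arbitrary: u)
    case (Cons x c)
    show ?case
    proof (cases c)
      case Nil
      then have "walk n k u [] w \<and> x # c = verts u []"
        using Cons.prems by (auto simp: k_max_chain_def)
      then show ?thesis
        by blast
    next
      case (Cons y c')
      then have "k_bruhat_cover n k u y" and "k_max_chain n k y w c" and "x = u"
        using Cons.prems by (auto simp: k_max_chain_def)
      then obtain t ts where "kstep n k u t" "y = act u t" "walk n k y ts w" "c = verts y ts"
        using Cons.IH k_bruhat_cover_iff by blast
      then have "walk n k u (t # ts) w \<and> x # c = verts u (t # ts)"
        using \<open>x = u\<close> by simp
      then show ?thesis
        by blast
    qed
  qed (simp add: k_max_chain_def)
next
  assume "\<exists>ts. walk n k u ts w \<and> c = verts u ts"
  then obtain ts where "walk n k u ts w" "c = verts u ts"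
    by blast
  then show "k_max_chain n k u w c"
  proof (induction ts arbitrary: u c)
    case (Cons t ts)
    then have "k_max_chain n k (act u t) w (verts (act u t) ts)" "k_bruhat_cover n k u (act u t)"
      using k_bruhat_cover_iff unfolding walk.simps by blast+
    then show ?case
      using Cons.prems hd_verts[of "act u t" ts]
      by (auto simp: k_max_chain_def successively_Cons)
  qed (simp add: k_max_chain_def)
qed

lemma verts_bruhat_le:
  "walk n k x ts w \<Longrightarrow> x permutes {1..n} \<Longrightarrow> y \<in> set (verts x ts) \<Longrightarrow>
    y permutes {1..n} \<and> bruhat_le n x y \<and> bruhat_le n y w"
proof (induction ts arbitrary: x y)
  case (Cons t ts)
  have step: "bruhat_step n x (act x t)" and p: "act x t permutes {1..n}"
    using Cons.prems(1) kstep_bruhat_step kstep_permutes unfolding walk.simps by blast+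
  have IH: "z permutes {1..n} \<and> bruhat_le n x z \<and> bruhat_le n z w"
    if "z \<in> set (verts (act x t) ts)" for z
    using Cons.IH[OF _ p that] Cons.prems(1) step
    by (auto simp: bruhat_le_def intro: converse_rtranclp_into_rtranclp)
  have "bruhat_le n x w"
    using IH[of "act x t"] hd_verts[of "act x t" ts] step
    by (metis (mono_tags, lifting) bruhat_le_def list.set_intros(1) rtranclp_trans)
  then show ?case
    using Cons.prems(2,3) IH by (auto simp: bruhat_le_def)
qed (simp add: bruhat_le_def)

lemma verts_comparable:
  "walk n k x ts w \<Longrightarrow> x permutes {1..n} \<Longrightarrow> y \<in> set (verts x ts) \<Longrightarrow> z \<in> set (verts x ts) \<Longrightarrow>
    bruhat_le n y z \<or> bruhat_le n z y"
proof (induction ts arbitrary: x)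
  case (Cons t ts)
  have p: "act x t permutes {1..n}"
    using Cons.prems(1) kstep_permutes unfolding walk.simps by blast
  show ?case
  proof (cases "y = x \<or> z = x")
    case True
    then show ?thesis
      using verts_bruhat_le[OF Cons.prems(1,2)] Cons.prems(3,4) by blast
  next
    case False
    then show ?thesis
      using Cons.IH[OF _ p] Cons.prems by auto
  qed
qed (simp add: bruhat_le_def)

lemma img_in_sigma_complex:
  assumes "walk n k u ts w" "u permutes {1..n}"
  shows "img k u ts \<in> sigma_complex n k u w"
proof -
  have "set (verts u ts) \<in> order_complex (bruhat_le n) (bruhat_interval n u w)"
    using verts_bruhat_le[OF assms] verts_comparable[OF assms]
    by (auto simp: order_complex_def bruhat_interval_def)
  then show ?thesis
    unfolding sigma_complex_def img_verts by blast
qed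

text \<open>Every face lies in the image of a walk by \<open>chain_in_walk\<close>, and images of
  walks from \<open>u\<close> to \<open>w\<close> have equal cardinality, so none properly contains
  another.\<close>

lemma facets_sigma_complex:
  assumes "walk n k u ss w" "u permutes {1..n}" "k \<le> n"
  shows "facets (sigma_complex n k u w) = img k u ` {ts. walk n k u ts w}"
proof (intro equalityI subsetI)
  fix F
  assume "F \<in> facets (sigma_complex n k u w)"
  then have F: "F \<in> sigma_complex n k u w"
    and max: "\<And>G. G \<in> sigma_complex n k u w \<Longrightarrow> F \<subseteq> G \<Longrightarrow> F = G"
    by (auto simp: facets_def)
  obtain C where C: "C \<in> order_complex (bruhat_le n) (bruhat_interval n u w)" "F = sigma k ` C"
    using F unfolding sigma_complex_def by blast
  obtain ts where "walk n k u ts w" "F \<subseteq> img k u ts"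
    using chain_in_walk[OF assms C(1)] C(2) by blast
  then show "F \<in> img k u ` {ts. walk n k u ts w}"
    using max img_in_sigma_complex assms(2) by blast
next
  fix F
  assume "F \<in> img k u ` {ts. walk n k u ts w}"
  then obtain ts where ts: "walk n k u ts w" "F = img k u ts"
    by blast
  have "F = G" if G: "G \<in> sigma_complex n k u w" "F \<subseteq> G" for G
  proof -
    obtain C where C: "C \<in> order_complex (bruhat_le n) (bruhat_interval n u w)" "G = sigma k ` C"
      using G(1) unfolding sigma_complex_def by blast
    obtain ds where ds: "walk n k u ds w" "G \<subseteq> img k u ds"
      using chain_in_walk[OF assms C(1)] C(2) by blast
    have "length ts = length ds"
      using walk_length[OF ts(1)] walk_length[OF ds(1)] by simp
    then have "card (img k u ds) = card F"
      using card_img[OF ts(1)] card_img[OF ds(1)] ts(2) by simp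
    then have "F = img k u ds"
      using G(2) ds(2) by (intro card_subset_eq finite_img) auto
    then show ?thesis
      using G(2) ds(2) by blast
  qed
  then show "F \<in> facets (sigma_complex n k u w)"
    using img_in_sigma_complex[OF ts(1) assms(2)] ts(2) by (auto simp: facets_def)
qed

end

section \<open>The shelling\<close>

context
  fixes n k :: nat
begin

lemma img_split:
  assumes "walk n k x ts w" "S \<in> img k x ts"
  shows "\<exists>p r y. ts = p @ r \<and> walk n k x p y \<and> walk n k y r w \<and> S = sigma k y"
  using assms
proof (induction ts arbitrary: x)
  case Nil
  have "walk n k x [] x"
    by simp
  with Nil show ?case
    by auto
next
  case (Cons t ts)
  show ?case
  proof (cases "S = sigma k x")
    case True
    have "walk n k x [] x"
      by simp
    with True Cons.prems(1) show ?thesis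
      by blast
  next
    case False
    then obtain p r y where
      "ts = p @ r" "walk n k (act x t) p y" "walk n k y r w" "S = sigma k y"
      using Cons.IH[of "act x t"] Cons.prems by auto
    then have "t # ts = (t # p) @ r \<and> walk n k x (t # p) y \<and> walk n k y r w \<and> S = sigma k y"
      using Cons.prems(1) by simp
    then show ?thesis
      by blast
  qed
qed

lemma img_sum_le:
  assumes "walk n k x ts w" "S \<in> img k x ts"
  shows "\<Sum>S \<le> \<Sum>(sigma k w)"
proof -
  obtain y r where "walk n k y r w" "S = sigma k y"
    using img_split[OF assms] by blast
  with img_sum_ge[OF this(1) end_in_img[OF this(1)]] show ?thesis
    by simp
qed

lemma not_sorted_wrt_adjacent:
  assumes "transp R" "\<not> sorted_wrt R xs"
  shows "\<exists>as x y bs. xs = as @ x # y # bs \<and> \<not> R x y"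
proof -
  have "\<not> successively R xs"
    using assms successively_conv_sorted_wrt by blast
  then show ?thesis
  proof (induction xs)
    case (Cons a xs)
    then obtain b xs' where xs: "xs = b # xs'"
      by (cases xs) auto
    show ?case
    proof (cases "R a b")
      case True
      then have "\<not> successively R xs"
        using Cons.prems xs by simp
      then obtain as x y bs where "xs = as @ x # y # bs" "\<not> R x y"
        using Cons.IH by blast
      then have "a # xs = (a # as) @ x # y # bs \<and> \<not> R x y"
        by simp
      then show ?thesis
        by blast
    next
      case False
      then have "a # xs = [] @ a # b # xs' \<and> \<not> R a b"
        using xs by simp
      then show ?thesis
        by blast
    qed
  qed simp
qed

text \<open>Consider the labels up to the first vertex after \<open>x\<close> whose image lies in
  the competing facet. Were they increasing, all would exceed \<open>s\<close> and
  \<open>increasing_walk_first\<close> would exclude the meeting. So there is a descent, and its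
  middle vertex comes strictly before the meeting.\<close>

lemma descent_before_meeting:
  assumes x: "x permutes {1..n}" and R: "walk n k x (t # ts) w" and s: "kstep n k x s"
    and ds: "walk n k (act x s) ds w" and less: "label_less w s t"
  shows "\<exists>as p q bs y. t # ts = as @ p # q # bs \<and> \<not> label_less w p q \<and>
    walk n k x (as @ [p]) y \<and> sigma k y \<notin> img k (act x s) ds"
proof -
  let ?D = "img k (act x s) ds"
  \<comment> \<open>The bound \<open>1 \<le> m\<close> leaves out the common vertex
    \<open>x\<close>; the full length satisfies \<open>Q\<close> because both walks end at
    \<open>w\<close>.\<close>
  define Q where "Q m \<longleftrightarrow> 1 \<le> m \<and> m \<le> Suc (length ts) \<and>
    (\<forall>y. walk n k x (take m (t # ts)) y \<longrightarrow> sigma k y \<in> ?D)" for m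
  have "Q (Suc (length ts))"
  proof -
    have "sigma k y \<in> ?D" if "walk n k x (t # ts) y" for y
      using walk_fun[OF that R] end_in_img[OF ds] by simp
    then show ?thesis
      unfolding Q_def by simp
  qed
  define m where "m = (LEAST m. Q m)"
  have m: "Q m" and min: "\<And>l. l < m \<Longrightarrow> \<not> Q l"
    using LeastI[of Q, OF \<open>Q (Suc (length ts))\<close>] not_less_Least unfolding m_def by auto
  obtain us vs where split: "t # ts = us @ vs" and us_def: "us = take m (t # ts)"
    by (metis append_take_drop_id)
  have len: "length us = m"
    using m by (simp add: Q_def us_def)
  obtain y where us: "walk n k x us y" and vs: "walk n k y vs w"
    using R unfolding split by (auto simp: walk_append)
  have "sigma k y \<in> ?D"
    using m us by (simp add: Q_def us_def)
  then obtain p y' where y': "walk n k (act x s) p y'" "sigma k y' = sigma k y"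
    using img_split[OF ds] by metis
  have "us \<noteq> []"
    using m len by (auto simp: Q_def)
  then obtain us' where us': "us = t # us'"
    using split by (cases us) auto
  have "\<not> sorted_wrt (label_less w) us"
  proof
    assume sorted: "sorted_wrt (label_less w) us"
    obtain e f where s_eq: "s = (e, f)"
      by (cases s)
    have "\<forall>r\<in>set us. label_less w s r"
      using sorted less label_less_trans unfolding us' by auto
    with increasing_walk_first[OF x us vs sorted] s y' show False
      unfolding s_eq by blast
  qed
  moreover have "transp (label_less w)"
    using label_less_trans by (rule transpI)
  ultimately obtain as p q bs where *: "us = as @ p # q # bs" "\<not> label_less w p q"
    using not_sorted_wrt_adjacent by blast
  have "\<not> Q (Suc (length as))"
    using min len * by simp
  moreover have "take (Suc (length as)) (t # ts) = as @ [p]"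
    unfolding split * by simp
  moreover have "Suc (length as) \<le> Suc (length ts)"
    using arg_cong[OF split, of length] * by simp
  ultimately obtain z where "walk n k x (as @ [p]) z" "sigma k z \<notin> ?D"
    unfolding Q_def by (metis One_nat_def Suc_le_mono le0)
  moreover have "t # ts = as @ p # q # (bs @ vs)"
    unfolding split * by simp
  ultimately show ?thesis
    using *(2) by blast
qed

text \<open>This is the whole combinatorial content of the shelling: the descent vertex found after
  the walks part is missed by \<open>ds\<close>, and \<open>descent_exchange\<close> replaces it
  while lowering the word.\<close>

lemma lex_exchange:
  assumes u: "u permutes {1..n}" and ts: "walk n k u ts w" and ds: "walk n k u ds w"
    and lex: "(ds, ts) \<in> lexord {(a, b). label_less w a b}"
  shows "\<exists>S ts'. S \<in> img k u ts \<and> S \<notin> img k u ds \<and> walk n k u ts' w \<and>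
    (ts', ts) \<in> lexord {(a, b). label_less w a b} \<and> img k u ts - {S} \<subseteq> img k u ts'"
proof -
  \<comment> \<open>Equal lengths rule out the proper-prefix case of \<open>lexord\<close>, so the
    words part at two comparable labels.\<close>
  have len: "length ts = length ds"
    using walk_length[OF ts] walk_length[OF ds] by simp
  obtain pre s t r1 r2 where d: "label_less w s t" "ds = pre @ s # r2" "ts = pre @ t # r1"
    using lex len unfolding lexord_def by auto
  obtain x where pre: "walk n k u pre x" and R: "walk n k x (t # r1) w"
    using ts unfolding d walk_append by blast
  have s: "kstep n k x s" and r2: "walk n k (act x s) r2 w"
    using ds pre walk_fun unfolding d walk_append by fastforce+
  have x: "x permutes {1..n}"
    by (rule walk_permutes[OF pre u])
  obtain as p q bs y where *: "t # r1 = as @ p # q # bs" "\<not> label_less w p q"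
    "walk n k x (as @ [p]) y" "sigma k y \<notin> img k (act x s) r2"
    using descent_before_meeting[OF x R s r2 d(1)] by blast
  obtain z where as: "walk n k x as z" and p: "kstep n k z p" and y: "y = act z p"
    using *(3) by (auto simp: walk_append)
  have "walk n k z (p # q # bs) w"
    using R as walk_fun unfolding * walk_append by blast
  then have q: "kstep n k (act z p) q" and bs: "walk n k (act (act z p) q) bs w"
    by auto
  obtain s' rs where s': "label_less w s' p" "walk n k z (s' # rs) w"
    "img k (act (act z p) q) bs \<subseteq> img k z (s' # rs)"
    using descent_exchange[OF p q bs *(2)] by blast
  let ?ts = "pre @ as @ s' # rs"
  have pas: "walk n k u (pre @ as) z"
    using pre as by (auto simp: walk_append)
  have ts_eq: "ts = (pre @ as) @ p # q # bs"
    unfolding d * by simp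
  have img_ts: "img k u ts = img k u (pre @ as) \<union> {sigma k z, sigma k y} \<union>
      img k (act (act z p) q) bs"
    unfolding ts_eq img_append[OF pas] y by auto
  have "walk n k u ?ts w"
    using pas s'(2) walk_append[of n k u "pre @ as"] by auto
  moreover have "(?ts, ts) \<in> lexord {(a, b). label_less w a b}"
    unfolding ts_eq using s'(1) by (auto intro!: lexord_append_leftI)
  moreover have "img k u ts - {sigma k y} \<subseteq> img k u ?ts"
    using img_append[OF pas, of "s' # rs"] s'(3) unfolding img_ts by auto
  moreover have "sigma k y \<in> img k u ts"
    unfolding img_ts by blast
  \<comment> \<open>After the parting this is the choice of \<open>y\<close>. Up to the parting it
    follows from sums, since \<open>y\<close> comes after every vertex of the walk
    \<open>pre @ as\<close>.\<close>
  moreover have "sigma k y \<notin> img k u ds"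
  proof
    assume "sigma k y \<in> img k u ds"
    then have "sigma k y \<in> img k u pre"
      using img_append[OF pre, of "s # r2"] *(4) end_in_img[OF pre] unfolding d by auto
    then have "sigma k y \<in> img k u (pre @ as)"
      using img_append[OF pre, of as] by blast
    then show False
      using img_sum_le[OF pas] kstep_sum_sigma[OF p] y by fastforce
  qed
  ultimately show ?thesis
    by blast
qed

section \<open>The lexicographic order on facets\<close>

lemma walk_lex_linear:
  assumes "walk n k u ts w" "w permutes {1..n}"
  shows "ts = ds \<or> (ts, ds) \<in> lexord {(a, b). label_less w a b} \<or>
    (ds, ts) \<in> lexord {(a, b). label_less w a b}"
  using lexord_linear[of "{(a, b). label_less w a b}" ts ds] label_less_total[OF assms(2)] by auto

lemma lexord_label_trans:
  "(a, b) \<in> lexord {(a, b). label_less w a b} \<Longrightarrow> (b, c) \<in> lexord {(a, b). label_less w a b} \<Longrightarrow>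
    (a, c) \<in> lexord {(a, b). label_less w a b}"
  by (erule (1) lexord_trans) (auto intro: transI label_less_trans)

lemma lexord_label_irrefl: "(a, a) \<notin> lexord {(a, b). label_less w a b}"
  by (rule lexord_irreflexive) (auto simp: label_less_irrefl)

text \<open>Of two distinct walks one is lexicographically earlier, and \<open>lex_exchange\<close>
  produces a vertex image of the later one that the earlier one misses.\<close>

lemma img_inj:
  assumes "u permutes {1..n}"
  shows "inj_on (img k u) {ts. walk n k u ts w}"
proof (rule inj_onI, unfold mem_Collect_eq)
  fix ts ds
  assume *: "walk n k u ts w" "walk n k u ds w" "img k u ts = img k u ds"
  have w: "w permutes {1..n}"
    using walk_permutes[OF *(1) assms] .
  show "ts = ds"
    using walk_lex_linear[OF *(1) w, of ds] lex_exchange[OF assms *(1,2)]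
      lex_exchange[OF assms *(2,1)] *(3) by blast
qed

lemma facet_chain_img:
  assumes "walk n k u ts w" "u permutes {1..n}"
  shows "facet_chain n k u w (img k u ts) = verts u ts"
  unfolding facet_chain_def
proof (rule the_equality)
  show "k_max_chain n k u w (verts u ts) \<and> sigma k ` set (verts u ts) = img k u ts"
    using assms(1) by (auto simp: k_max_chain_iff img_verts)
next
  fix c
  assume "k_max_chain n k u w c \<and> sigma k ` set c = img k u ts"
  then obtain ds where ds: "walk n k u ds w" "c = verts u ds" "img k u ds = img k u ts"
    by (auto simp: k_max_chain_iff img_verts)
  then have "ds = ts"
    using img_inj[OF assms(2), of w] assms(1) by (auto simp: inj_on_def)
  with ds show "c = verts u ts"
    by simp
qed

lemma facet_lex_less_img:
  assumes "walk n k u ts w" "walk n k u ds w" "u permutes {1..n}"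
  shows "facet_lex_less n k u w (img k u ts) (img k u ds) \<longleftrightarrow>
    (ts, ds) \<in> lexord {(a, b). label_less w a b}"
  unfolding facet_lex_less_def chain_lex_less_def
  using assms by (simp add: facet_chain_img chain_labels_verts)

lemma finite_walks: "finite {ts. walk n k u ts w}"
proof (rule finite_subset)
  have "set ts \<subseteq> {1..n} \<times> {1..n}" if "walk n k u ts w" for ts
    using that by (induction ts arbitrary: u) (auto simp: kstep_def)
  then show "{ts. walk n k u ts w} \<subseteq> {ts. set ts \<subseteq> {1..n} \<times> {1..n} \<and>
      length ts = perm_length n w - perm_length n u}"
    using walk_length by force
qed (simp add: finite_lists_length_eq)

lemma facet_lex_less_ex1:
  assumes "walk n k u ss w" "u permutes {1..n}" "k \<le> n"
  shows "\<exists>!Fs. set Fs = facets (sigma_complex n k u w) \<and> distinct Fs \<and>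
    sorted_wrt (facet_lex_less n k u w) Fs"
proof -
  let ?L = "facet_lex_less n k u w" and ?A = "facets (sigma_complex n k u w)"
  have A: "?A = img k u ` {ts. walk n k u ts w}"
    by (rule facets_sigma_complex[OF assms])
  have trans: "?L F H" if FGH: "F \<in> ?A" "G \<in> ?A" "H \<in> ?A" "?L F G" "?L G H" for F G H
  proof -
    obtain a b c where *: "walk n k u a w" "F = img k u a" "walk n k u b w" "G = img k u b"
      "walk n k u c w" "H = img k u c"
      using FGH(1-3) unfolding A by blast
    show ?thesis
      using FGH(4,5) lexord_label_trans[of a b w c] facet_lex_less_img[OF _ _ assms(2)] *
      by simp
  qed
  have irrefl: "\<not> ?L F F" if "F \<in> ?A" for F
    using that facet_lex_less_img[OF _ _ assms(2)] lexord_label_irrefl unfolding A by blast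
  have w: "w permutes {1..n}"
    by (rule walk_permutes[OF assms(1,2)])
  have total: "?L F G \<or> ?L G F" if FG: "F \<in> ?A" "G \<in> ?A" "F \<noteq> G" for F G
  proof -
    obtain a b where *: "walk n k u a w" "F = img k u a" "walk n k u b w" "G = img k u b"
      using FG(1,2) unfolding A by blast
    then have "a \<noteq> b"
      using FG(3) by blast
    then show ?thesis
      using walk_lex_linear[OF *(1) w, of b] facet_lex_less_img[OF _ _ assms(2)] * by auto
  qed
  have "finite ?A"
    unfolding A using finite_walks by (rule finite_imageI)
  from sorted_wrt_exists[OF this, of ?L] trans total irrefl
  obtain Fs where Fs: "set Fs = ?A" "distinct Fs" "sorted_wrt ?L Fs"
    by blast
  show ?thesis
  proof (rule ex1I[of _ Fs])
    fix Gs
    assume "set Gs = ?A \<and> distinct Gs \<and> sorted_wrt ?L Gs"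
    then show "Gs = Fs"
      using Fs trans irrefl by (intro sorted_wrt_unique[of ?L]) blast+
  qed (use Fs in blast)
qed

lemma lex_shelling_order:
  assumes walk: "walk n k u ss w" "u permutes {1..n}" "k \<le> n"
    and Fs: "set Fs = facets (sigma_complex n k u w)" "distinct Fs"
      "sorted_wrt (facet_lex_less n k u w) Fs"
  shows "shelling_order (sigma_complex n k u w) Fs"
proof -
  let ?L = "facet_lex_less n k u w" and ?K = "sigma_complex n k u w"
  \<comment> \<open>A walk with \<open>m\<close> labels has a facet with \<open>m + 1\<close>
    elements, so the facets have dimension \<open>?d - 1 = length ss\<close>.\<close>
  let ?d = "int (length ss) + 1"
  have A: "facets ?K = img k u ` {ts. walk n k u ts w}"
    by (rule facets_sigma_complex[OF walk])
  have card: "card F = Suc (length ss)" "finite F" if "F \<in> facets ?K" for F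
    using that card_img walk_length[OF walk(1)] walk_length finite_img unfolding A by fastforce+
  have "pure_of_dim ?K (?d - 1)"
    using img_in_sigma_complex[OF walk(1,2)] card by (auto simp: pure_of_dim_def face_dim_def)
  moreover have "pure_of_dim (Pow (Fs ! i) \<inter> (\<Union>j<i. Pow (Fs ! j))) (?d - 2)"
    if i: "0 < i" "i < length Fs" for i
  proof -
    let ?I = "Pow (Fs ! i) \<inter> (\<Union>j<i. Pow (Fs ! j))"
    have Fi: "Fs ! i \<in> facets ?K"
      using i Fs(1) nth_mem by blast
    have earlier: "\<exists>S. S \<in> Fs ! i \<and> S \<notin> Fs ! j \<and> Fs ! i - {S} \<in> ?I" if j: "j < i" for j
    proof -
      have Fj: "Fs ! j \<in> facets ?K"
        using i j Fs(1) nth_mem by (metis order.strict_trans)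
      obtain ts ds where ts: "walk n k u ts w" "Fs ! i = img k u ts"
        and ds: "walk n k u ds w" "Fs ! j = img k u ds"
        using Fi Fj unfolding A by blast
      have "?L (Fs ! j) (Fs ! i)"
        using sorted_wrt_nth_less[OF Fs(3) j i(2)] .
      then have "(ds, ts) \<in> lexord {(a, b). label_less w a b}"
        using facet_lex_less_img[OF ds(1) ts(1) walk(2)] ts(2) ds(2) by simp
      from lex_exchange[OF walk(2) ts(1) ds(1) this] obtain S ts' where
        S: "S \<in> img k u ts" "S \<notin> img k u ds" and ts': "walk n k u ts' w"
        "(ts', ts) \<in> lexord {(a, b). label_less w a b}" "img k u ts - {S} \<subseteq> img k u ts'"
        by blast
      have "img k u ts' \<in> set Fs"
        using ts'(1) unfolding Fs(1) A by blast
      then obtain l where l: "l < length Fs" "Fs ! l = img k u ts'"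
        by (auto simp: in_set_conv_nth)
      have "l < i"
      proof (rule ccontr)
        assume "\<not> l < i"
        then have "(ts, ts') \<in> lexord {(a, b). label_less w a b} \<or> img k u ts = img k u ts'"
          using sorted_wrt_nth_less[OF Fs(3), of i l] l ts
            facet_lex_less_img[OF ts(1) ts'(1) walk(2)] by (cases "l = i") auto
        moreover have "img k u ts = img k u ts' \<Longrightarrow> ts = ts'"
          using img_inj[OF walk(2), of w] ts(1) ts'(1) by (auto simp: inj_on_def)
        ultimately show False
          using ts'(2) lexord_label_trans lexord_label_irrefl by metis
      qed
      then have "Fs ! i - {S} \<in> ?I"
        using ts'(3) l(2) ts(2) by auto
      with S show ?thesis
        unfolding ts(2) ds(2) by blast
    qed
    have "face_dim F = ?d - 2" if F: "F \<in> facets ?I" for F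
    proof -
      obtain j where j: "j < i" "F \<subseteq> Fs ! i" "F \<subseteq> Fs ! j"
        and max: "\<And>G. G \<in> ?I \<Longrightarrow> F \<subseteq> G \<Longrightarrow> F = G"
        using F by (auto simp: facets_def)
      obtain S where S: "S \<in> Fs ! i" "S \<notin> Fs ! j" "Fs ! i - {S} \<in> ?I"
        using earlier[OF j(1)] by blast
      \<comment> \<open>\<open>F\<close> lies in both \<open>Fs ! i\<close> and
        \<open>Fs ! j\<close> and so misses \<open>S\<close>. It is thus contained in
        \<open>Fs ! i - {S}\<close>, a face of the intersection, and maximality forces
        equality.\<close>
      have "F = Fs ! i - {S}"
        using j S by (intro max) auto
      then show ?thesis
        using card[OF Fi] S(1) by (simp add: face_dim_def)
    qed
    moreover have "?I \<noteq> {}"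
      using i by auto
    ultimately show ?thesis
      by (simp add: pure_of_dim_def)
  qed
  ultimately show ?thesis
    using Fs(1,2) unfolding shelling_order_def by blast
qed

end

theorem theorem10p2:
  fixes n k :: nat and u w :: "nat \<Rightarrow> nat"
  assumes "k \<le> n"
    and "u permutes {1..n}" and "w permutes {1..n}"
    and "k_bruhat_le n k u w"
  shows "(\<exists>!Fs. set Fs = facets (sigma_complex n k u w) \<and> distinct Fs \<and>
            sorted_wrt (facet_lex_less n k u w) Fs) \<and>
         (\<forall>Fs. set Fs = facets (sigma_complex n k u w) \<and> distinct Fs \<and>
            sorted_wrt (facet_lex_less n k u w) Fs \<longrightarrow>
            shelling_order (sigma_complex n k u w) Fs)"
proof -
  obtain ss where "walk n k u ss w"
    using k_bruhat_le_walk[OF assms(4)] by blast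
  then show ?thesis
    using facet_lex_less_ex1 lex_shelling_order assms(1,2) by blast
qed

end
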